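(* A metric space is isometric to $(\mathbb{R}^n,d_e)$ for some integer $n > 0$ if and only if it is two-point dilation-homogeneous and contains a compact set with non-empty interior as well as three distinct points that are metrically collinear.
   Context: $d_e$ is the Euclidean metric on $\mathbb{R}^n$. A dilation on a metric space $(X,d)$ is a bijection $u\colon X \to X$ for which there is a real constant $r>0$ with $d(u(x),u(y)) = r\, d(x,y)$ for all $x,y \in X$. The space $(X,d)$ is two-point dilation-homogeneous if for any three distinct points $a,b,c \in X$ there exists a dilation $u\colon X\to X$ such that $u(a)=a$ and $u(b)=c$. Three points $x,y,z$ of $X$ are metrically collinear if $d(x,z)=d(x,y)+d(y,z)$. *)

theory Defs
  imports "HOL-Analysis.Analysis"
begin

text \<open>
  A metric space is a carrier set \<open>M\<close> with a distance function \<open>d\<close>, as in the library locale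
  \<^locale>\<open>Metric_space\<close>; the notions below only look at \<open>d\<close> on \<open>M\<close>.
\<close>

definition isometric :: "'a set \<Rightarrow> ('a \<Rightarrow> 'a \<Rightarrow> real) \<Rightarrow> 'b set \<Rightarrow> ('b \<Rightarrow> 'b \<Rightarrow> real) \<Rightarrow> bool" where
  "isometric M d M' d' \<longleftrightarrow>
     (\<exists>f. bij_betw f M M' \<and> (\<forall>x\<in>M. \<forall>y\<in>M. d' (f x) (f y) = d x y))"

definition dilation :: "'a set \<Rightarrow> ('a \<Rightarrow> 'a \<Rightarrow> real) \<Rightarrow> ('a \<Rightarrow> 'a) \<Rightarrow> bool" where
  "dilation M d u \<longleftrightarrow>
     bij_betw u M M \<and> (\<exists>r>0. \<forall>x\<in>M. \<forall>y\<in>M. d (u x) (u y) = r * d x y)"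

definition two_point_dilation_homogeneous :: "'a set \<Rightarrow> ('a \<Rightarrow> 'a \<Rightarrow> real) \<Rightarrow> bool" where
  "two_point_dilation_homogeneous M d \<longleftrightarrow>
     (\<forall>a\<in>M. \<forall>b\<in>M. \<forall>c\<in>M. a \<noteq> b \<and> b \<noteq> c \<and> a \<noteq> c \<longrightarrow>
        (\<exists>u. dilation M d u \<and> u a = a \<and> u b = c))"

definition metrically_collinear :: "('a \<Rightarrow> 'a \<Rightarrow> real) \<Rightarrow> 'a \<Rightarrow> 'a \<Rightarrow> 'a \<Rightarrow> bool" where
  "metrically_collinear d x y z \<longleftrightarrow> d x z = d x y + d y z"

text \<open>
  The dimension is quantified inside the theorem, so \<open>\<real>\<^sup>n\<close> is represented as the carrier of the
  library's \<^const>\<open>Euclidean_space\<close>: the sequences that vanish from index \<open>n\<close> on.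
\<close>

definition euclidean_carrier :: "nat \<Rightarrow> (nat \<Rightarrow> real) set" where
  "euclidean_carrier n = topspace (Euclidean_space n)"

definition euclidean_dist :: "nat \<Rightarrow> (nat \<Rightarrow> real) \<Rightarrow> (nat \<Rightarrow> real) \<Rightarrow> real" where
  "euclidean_dist n x y = sqrt (\<Sum>i<n. (x i - y i)\<^sup>2)"

lemma Metric_space_euclidean: "Metric_space (euclidean_carrier n) (euclidean_dist n)"
proof
  fix x y z :: "nat \<Rightarrow> real"
  show "0 \<le> euclidean_dist n x y"
    by (simp add: euclidean_dist_def sum_nonneg)
  show "euclidean_dist n x y = euclidean_dist n y x"
    by (simp add: euclidean_dist_def power2_commute)
  show "euclidean_dist n x z \<le> euclidean_dist n x y + euclidean_dist n y z"
    using L2_set_triangle_ineq[of "\<lambda>i. x i - y i" "\<lambda>i. y i - z i" "{..<n}"]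
    by (simp add: euclidean_dist_def L2_set_def)
  assume "x \<in> euclidean_carrier n" "y \<in> euclidean_carrier n"
  then have *: "x i = y i" if "\<not> i < n" for i
    using that by (simp add: euclidean_carrier_def topspace_Euclidean_space)
  have "euclidean_dist n x y = 0 \<longleftrightarrow> (\<forall>i<n. x i = y i)"
    by (auto simp: euclidean_dist_def sum_nonneg_eq_0_iff)
  then show "euclidean_dist n x y = 0 \<longleftrightarrow> x = y"
    using * by (auto simp: fun_eq_iff)
qed

end

theory Submission
  imports Defs
begin

text \<open>
The substantial direction starts from a space in which every pair of distinct points can be moved to
every other such pair by a dilation (\<open>similarity_on_pairs\<close>), so that pairs at equal distance are
related by an isometry. One collinear triple then provides, between any two points, a point that
divides their distance in a fixed proportion, and one compact ball provides compactness of all closed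
balls; together they give points dividing every distance in every proportion
(\<open>between_points\<close>, \<open>compact_balls\<close>).

The key step is that the squared distance is a kernel of negative type (\<open>negative_type\<close>), which says
that the space embeds isometrically into a Hilbert space. For a fixed point \<open>q\<close> the kernel
\<open>(d q a - d q b)\<^sup>2\<close> is of negative type, because it is the squared difference of the values of one
function, and averages of such kernels are again of negative type. If the average over all \<open>q\<close> is taken
with respect to an isometry-invariant mean \<open>\<Lambda>\<close>, then the result depends only on the distance of
\<open>a\<close> and \<open>b\<close>, so it is \<open>(\<phi> (d a b))\<^sup>2\<close> for a function \<open>\<phi>\<close>. The triangle inequality in
\<open>L\<^sup>2\<close> makes \<open>\<phi>\<close> subadditive along geodesics, hence \<open>\<phi> r / r\<close> converges for \<open>r \<rightarrow> 0\<close> to its supremum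
\<open>c > 0\<close>. Rescaling by dilations turns the kernel into \<open>c\<^sup>2\<close> times the squared distance.

The mean is constructed as in the proof of existence of Haar measure (\<open>invariant_mean_exists\<close>). The
fractional covering number of a function by balls of radius \<open>\<epsilon>\<close> is sublinear and
isometry-invariant, and it becomes additive on Lipschitz functions for \<open>\<epsilon> \<rightarrow> 0\<close>
(\<open>cover_cost_add_ge\<close>). Restricted to balls of growing radius it is almost invariant, because
dilations make the space uniformly doubling (\<open>cover_cost_doubling\<close>). The average is not zero:
a chain of \<open>n\<close> unit steps joins points at distance \<open>n\<close>, whose distance functions differ by a
multiple of \<open>n\<close> on a definite proportion of the ball, so by the Cauchy-Schwarz inequality a single step has a definite mean
square (\<open>cover_cost_lower_bound\<close>).

Negative type and collinearity give Stewart's theorem (\<open>stewart\<close>). It says that the polarized form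
\<open>gram p\<close> of the squared distance is affine along geodesics; since geodesics can be extended,
multiples and sums of points exist, and the space is a real vector space with inner product
\<open>gram p\<close> and origin \<open>p\<close>. Compactness of the unit ball bounds the size of orthonormal families, and
the coordinates with respect to a maximal one are the isometry onto \<open>\<real>\<^sup>n\<close>.

Conversely, in Euclidean space a reflection exchanges two given vectors of equal length; composed with
a scaling it is the required dilation.
\<close>

section \<open>Limits along filters and subadditive functions\<close>

text \<open>
This is Tychonoff's theorem for a product of compact intervals. The index set may be uncountable (it
is used for the set of all test functions), so that in general no subsequence converges in every
coordinate; a cluster point still provides a filter finer than \<^const>\<open>sequentially\<close> along which all
coordinates converge, and that is enough to pass to the limit in inequalities.
\<close>

lemma pointwise_limit_along_filter:
  fixes f :: "nat \<Rightarrow> 'i \<Rightarrow> real"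
  assumes bound: "\<And>n i. i \<in> I \<Longrightarrow> \<bar>f n i\<bar> \<le> C i"
  obtains G where "G \<noteq> bot" "G \<le> sequentially"
    "\<And>i. i \<in> I \<Longrightarrow> ((\<lambda>n. f n i) \<longlongrightarrow> Lim G (\<lambda>n. f n i)) G"
proof -
  define g where "g n i = (if i \<in> I then f n i else 0)" for n i
  define K :: "('i \<Rightarrow> real) set" where "K = (\<Pi>\<^sub>E i\<in>UNIV. {- \<bar>C i\<bar>..\<bar>C i\<bar>})"
  have "compactin (product_topology (\<lambda>i. euclidean) UNIV) K"
    unfolding K_def by (subst compactin_PiE) auto
  then have "compact K"
    by (simp add: euclidean_product_topology)
  moreover have "g n \<in> K" for n
  proof -
    have "g n i \<in> {- \<bar>C i\<bar>..\<bar>C i\<bar>}" for i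
    proof (cases "i \<in> I")
      case True
      show ?thesis
        using bound[OF True, of n] True unfolding g_def by auto
    qed (simp add: g_def)
    then show ?thesis
      by (simp add: K_def PiE_UNIV_domain)
  qed
  ultimately have "compact K" "\<And>n. g n \<in> K"
    by blast+
  moreover from this have "eventually (\<lambda>x. x \<in> K) (filtermap g sequentially)"
    by (simp add: eventually_filtermap)
  ultimately obtain x where x: "inf (nhds x) (filtermap g sequentially) \<noteq> bot"
    unfolding compact_filter by (metis filtermap_bot_iff sequentially_bot)
  define G where "G = inf sequentially (filtercomap g (nhds x))"
  have "G \<noteq> bot"
  proof
    assume "G = bot"
    then have "eventually (\<lambda>_. False) G"
      by simp
    then obtain P Q where P: "eventually P sequentially" and Q: "eventually Q (filtercomap g (nhds x))"
      and PQ: "\<And>n. P n \<Longrightarrow> Q n \<Longrightarrow> False"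
      unfolding G_def eventually_inf by blast
    from Q obtain R where R: "eventually R (nhds x)" "\<And>n. R (g n) \<Longrightarrow> Q n"
      unfolding eventually_filtercomap by blast
    have "eventually (\<lambda>y. \<not> R y) (filtermap g sequentially)"
      unfolding eventually_filtermap using P by eventually_elim (use PQ R in blast)
    with R(1) have "eventually (\<lambda>_. False) (inf (nhds x) (filtermap g sequentially))"
      unfolding eventually_inf by blast
    then show False
      using x by (simp add: trivial_limit_def)
  qed
  moreover have "G \<le> sequentially"
    by (simp add: G_def)
  moreover have "((\<lambda>n. f n i) \<longlongrightarrow> Lim G (\<lambda>n. f n i)) G" if "i \<in> I" for i
  proof -
    have "filterlim g (nhds x) G"
      unfolding G_def by (meson filterlim_def filtermap_filtercomap filtermap_mono inf_le2 order_trans)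
    then have "((\<lambda>n. g n i) \<longlongrightarrow> x i) G"
      using continuous_on_tendsto_compose[OF continuous_on_product_coordinates[of i], of g x G] by simp
    then have lim: "((\<lambda>n. f n i) \<longlongrightarrow> x i) G"
      using that by (simp add: g_def)
    then have "Lim G (\<lambda>n. f n i) = x i"
      by (rule tendsto_Lim[OF \<open>G \<noteq> bot\<close>])
    with lim show ?thesis
      by simp
  qed
  ultimately show thesis
    by (rule that)
qed

text \<open>
The hypothesis is what Young's inequality \<open>(u + v)\<^sup>2 \<le> (1 + t) u\<^sup>2 + (1 + 1 / t) v\<^sup>2\<close> yields after
averaging; optimizing over \<open>t\<close> recovers Minkowski's inequality.
\<close>

lemma sqrt_le_add_sqrt:
  fixes A B W :: real
  assumes "0 \<le> A" "0 \<le> B" and W: "\<And>t. t > 0 \<Longrightarrow> W \<le> (1 + t) * A + (1 + 1 / t) * B"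
  shows "sqrt W \<le> sqrt A + sqrt B"
proof -
  define a b where "a = sqrt A" and "b = sqrt B"
  have ab: "0 \<le> a" "0 \<le> b" "A = a\<^sup>2" "B = b\<^sup>2"
    using assms by (auto simp: a_def b_def)
  \<comment> \<open>The optimal parameter is \<open>t = b / a\<close>; the shift by \<open>e\<close> covers the case that \<open>a\<close> or \<open>b\<close> vanishes.\<close>
  have *: "W \<le> (a + b) * (a + b + 2 * e)" if "e > 0" for e
  proof -
    have "W \<le> (1 + (b + e) / (a + e)) * A + (1 + 1 / ((b + e) / (a + e))) * B"
      using ab that by (intro W) (auto intro!: divide_pos_pos)
    also have "\<dots> = (a + b + 2 * e) * (a * (a / (a + e))) + (a + b + 2 * e) * (b * (b / (b + e)))"
      using ab that by (simp add: field_simps power2_eq_square)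
    also have "\<dots> \<le> (a + b + 2 * e) * (a * 1) + (a + b + 2 * e) * (b * 1)"
      using ab that by (intro add_mono mult_left_mono) auto
    finally show ?thesis
      by (simp add: algebra_simps)
  qed
  have "((\<lambda>e. (a + b) * (a + b + 2 * e)) \<longlongrightarrow> (a + b) * (a + b + 2 * 0)) (at_right 0)"
    by (intro tendsto_intros)
  moreover have "eventually (\<lambda>e. W \<le> (a + b) * (a + b + 2 * e)) (at_right 0)"
    using * by (auto simp: eventually_at_right_less intro: eventually_mono[OF eventually_at_right_less[of 0]])
  ultimately have "W \<le> (a + b) * (a + b + 2 * 0)"
    using tendsto_lowerbound trivial_limit_at_right_real by blast
  then have "W \<le> (a + b)\<^sup>2"
    by (simp add: power2_eq_square)
  then show ?thesis
    using ab unfolding a_def b_def by (metis add_nonneg_nonneg real_le_lsqrt real_sqrt_le_iff real_sqrt_abs abs_of_nonneg)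
qed

text \<open>
Fekete's lemma at zero: the limit is the supremum of the slopes. Cutting an interval of length \<open>R\<close>
into pieces of length \<open>r\<close> leaves a remainder shorter than \<open>r\<close>, so the slope at \<open>r\<close> falls below the
slope at \<open>R\<close> by at most \<open>r / R\<close>.
\<close>

lemma subadditive_slope_at_0:
  fixes \<phi> :: "real \<Rightarrow> real"
  assumes sub: "\<And>a b. 0 \<le> a \<Longrightarrow> 0 \<le> b \<Longrightarrow> \<phi> (a + b) \<le> \<phi> a + \<phi> b"
    and le: "\<And>r. 0 \<le> r \<Longrightarrow> \<phi> r \<le> r" and pos: "0 < \<phi> 1"
  obtains c where "c > 0" "((\<lambda>r. \<phi> r / r) \<longlongrightarrow> c) (at_right 0)"
proof -
  define c where "c = (SUP r\<in>{0<..}. \<phi> r / r)"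
  have bdd: "bdd_above ((\<lambda>r. \<phi> r / r) ` {0<..})"
    using le by (intro bdd_aboveI[of _ 1]) (auto simp: divide_le_eq_1)
  have up: "\<phi> r / r \<le> c" if "r > 0" for r
    unfolding c_def using that by (intro cSUP_upper bdd) auto
  have "c > 0"
    using up[of 1] pos by simp
  have mult: "\<phi> (real n * r + s) \<le> real n * \<phi> r + \<phi> s" if "0 \<le> r" "0 \<le> s" for n r s
  proof (induction n)
    case (Suc n)
    have "\<phi> (real (Suc n) * r + s) = \<phi> (r + (real n * r + s))"
      by (simp add: algebra_simps)
    also have "\<dots> \<le> \<phi> r + \<phi> (real n * r + s)"
      using that by (intro sub) auto
    finally show ?case
      using Suc by (simp add: algebra_simps)
  qed auto
  have low: "\<phi> R / R - r / R \<le> \<phi> r / r" if r: "0 < r" and R: "0 < R" "r < \<phi> R" for r R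
  proof -
    define n where "n = nat \<lfloor>R / r\<rfloor>"
    define s where "s = R - real n * r"
    have "real n \<le> R / r" "R / r < real n + 1"
      using r R by (auto simp: n_def)
    then have s: "0 \<le> s" "s < r" and nR: "real n * r \<le> R"
      using r by (auto simp: s_def field_simps)
    have "\<phi> R \<le> real n * \<phi> r + \<phi> s"
      using mult[of r s n] r s by (simp add: s_def)
    also have "\<phi> s \<le> r"
      using le[of s] s by simp
    finally have *: "\<phi> R - r \<le> real n * \<phi> r"
      by simp
    then have "\<phi> r > 0"
      using R by (smt (verit) mult_nonneg_nonpos of_nat_0_le_iff)
    have "(\<phi> R - r) * r \<le> real n * r * \<phi> r"
      using mult_right_mono[OF *, of r] r by (simp add: algebra_simps)
    also have "\<dots> \<le> R * \<phi> r"
      using nR \<open>\<phi> r > 0\<close> by simp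
    finally show ?thesis
      using r R by (simp add: field_simps)
  qed
  have "((\<lambda>r. \<phi> r / r) \<longlongrightarrow> c) (at_right 0)"
  proof (rule order_tendstoI)
    fix a assume "a < c"
    then obtain R where R: "R > 0" "max a 0 < \<phi> R / R"
      using \<open>c > 0\<close> less_cSUP_iff[OF _ bdd, of "max a 0"] unfolding c_def by (metis (no_types, lifting) greaterThan_iff greaterThan_non_empty max_less_iff_conj)
    then have "\<phi> R > 0"
      by (simp add: zero_less_divide_iff)
    have "((\<lambda>r. \<phi> R / R - r / R) \<longlongrightarrow> \<phi> R / R - 0 / R) (at_right 0)"
      using R by (intro tendsto_intros) auto
    then have "eventually (\<lambda>r. a < \<phi> R / R - r / R) (at_right 0)"
      using R by (intro order_tendstoD(1)) auto
    moreover have "eventually (\<lambda>r. r < \<phi> R) (at_right 0)"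
      using \<open>\<phi> R > 0\<close> by (intro order_tendstoD(2)[OF tendsto_ident_at])
    moreover have "eventually (\<lambda>r. 0 < r) (at_right (0::real))"
      by (rule eventually_at_right_less)
    ultimately show "eventually (\<lambda>r. a < \<phi> r / r) (at_right 0)"
      by eventually_elim (use low[OF _ R(1)] in fastforce)
  next
    fix a assume "c < a"
    then show "eventually (\<lambda>r. \<phi> r / r < a) (at_right 0)"
      by (intro eventually_mono[OF eventually_at_right_less[of 0]]) (use up in fastforce)
  qed
  with \<open>c > 0\<close> show thesis
    using that by blast
qed

section \<open>Similarities and fractional covering by balls\<close>

context Metric_space
begin

definition similarity :: "real \<Rightarrow> ('a \<Rightarrow> 'a) \<Rightarrow> bool" where
  "similarity r u \<longleftrightarrow> 0 < r \<and> bij_betw u M M \<and> (\<forall>x\<in>M. \<forall>y\<in>M. d (u x) (u y) = r * d x y)"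

lemma similarityD:
  assumes "similarity r u"
  shows "0 < r" "bij_betw u M M" "x \<in> M \<Longrightarrow> u x \<in> M"
    "x \<in> M \<Longrightarrow> y \<in> M \<Longrightarrow> d (u x) (u y) = r * d x y"
  using assms by (auto simp: similarity_def bij_betw_def)

lemma similarity_compose:
  assumes "similarity r u" "similarity s v"
  shows "similarity (s * r) (v \<circ> u)"
  using assms similarityD[OF assms(1)] unfolding similarity_def
  by (auto intro: bij_betw_trans)

lemma similarity_inverse:
  assumes u: "similarity r u"
  obtains v where "similarity (1 / r) v" "\<And>x. x \<in> M \<Longrightarrow> u (v x) = x" "\<And>x. x \<in> M \<Longrightarrow> v (u x) = x"
proof
  define v where "v = inv_into M u"
  note uD = similarityD[OF u]
  have v: "bij_betw v M M"
    unfolding v_def using uD(2) by (rule bij_betw_inv_into)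
  then have vM: "v x \<in> M" if "x \<in> M" for x
    using that by (auto simp: bij_betw_def)
  show uv: "u (v x) = x" if "x \<in> M" for x
    using that uD(2) by (simp add: v_def bij_betw_inv_into_right)
  show "v (u x) = x" if "x \<in> M" for x
    using that uD(2) by (simp add: v_def bij_betw_inv_into_left)
  have "d (v x) (v y) = 1 / r * d x y" if "x \<in> M" "y \<in> M" for x y
    using uD(4)[of "v x" "v y"] uD(1) that vM uv by simp
  with v uD(1) show "similarity (1 / r) v"
    by (simp add: similarity_def)
qed

lemma isometry_inverse:
  assumes h: "similarity 1 h"
  obtains k where "similarity 1 k" "\<And>x. x \<in> M \<Longrightarrow> h (k x) = x" "\<And>x. x \<in> M \<Longrightarrow> k (h x) = x"
proof -
  obtain k where "similarity (1 / 1) k" "\<And>x. x \<in> M \<Longrightarrow> h (k x) = x" "\<And>x. x \<in> M \<Longrightarrow> k (h x) = x"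
    by (rule similarity_inverse[OF h]) blast
  then show thesis
    by (intro that[of k]) auto
qed

text \<open>
A list of pairs of a weight and a centre stands for a weighted family of balls of radius \<open>\<epsilon>\<close>.
Lists are convenient because families are added by concatenation and centres may repeat.
\<close>

definition pile :: "real \<Rightarrow> (real \<times> 'a) list \<Rightarrow> 'a \<Rightarrow> real" where
  "pile \<epsilon> xs q = (\<Sum>(c, i)\<leftarrow>xs. if d i q < \<epsilon> then c else 0)"

abbreviation weight :: "(real \<times> 'a) list \<Rightarrow> real" where
  "weight xs \<equiv> (\<Sum>(c, i)\<leftarrow>xs. c)"

definition covers :: "real \<Rightarrow> ('a \<Rightarrow> real) \<Rightarrow> (real \<times> 'a) list \<Rightarrow> bool" where
  "covers \<epsilon> g xs \<longleftrightarrow> (\<forall>(c, i)\<in>set xs. 0 \<le> c \<and> i \<in> M) \<and> (\<forall>q\<in>M. g q \<le> pile \<epsilon> xs q)"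

text \<open>
This is the fractional covering number of \<open>g\<close> by balls of radius \<open>\<epsilon>\<close>, the functional from
which Haar measure is usually constructed. It is a meaningful quantity only for functions that admit
some cover, and the predicate \<open>coverable\<close> records this.
\<close>

definition cover_cost :: "real \<Rightarrow> ('a \<Rightarrow> real) \<Rightarrow> real" where
  "cover_cost \<epsilon> g = Inf {weight xs |xs. covers \<epsilon> g xs}"

definition coverable :: "real \<Rightarrow> ('a \<Rightarrow> real) \<Rightarrow> bool" where
  "coverable \<epsilon> g \<longleftrightarrow> (\<exists>xs. covers \<epsilon> g xs)"

lemma weight_nonneg: "covers \<epsilon> g xs \<Longrightarrow> 0 \<le> weight xs"
  unfolding covers_def by (intro sum_list_nonneg) auto

lemma pile_le_weight: "covers \<epsilon> g xs \<Longrightarrow> pile \<epsilon> xs q \<le> weight xs"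
  unfolding covers_def pile_def by (intro sum_list_mono) auto

lemma cover_cost_le: "covers \<epsilon> g xs \<Longrightarrow> cover_cost \<epsilon> g \<le> weight xs"
  unfolding cover_cost_def by (intro cInf_lower bdd_belowI[of _ 0]) (auto dest: weight_nonneg)

lemma cover_cost_greatest:
  assumes "coverable \<epsilon> g" "\<And>xs. covers \<epsilon> g xs \<Longrightarrow> z \<le> weight xs"
  shows "z \<le> cover_cost \<epsilon> g"
  unfolding cover_cost_def using assms by (intro cInf_greatest) (auto simp: coverable_def)

lemma cover_cost_nonneg: "coverable \<epsilon> g \<Longrightarrow> 0 \<le> cover_cost \<epsilon> g"
  by (intro cover_cost_greatest weight_nonneg)

lemma covers_mono: "covers \<epsilon> g xs \<Longrightarrow> (\<And>q. q \<in> M \<Longrightarrow> f q \<le> g q) \<Longrightarrow> covers \<epsilon> f xs"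
  unfolding covers_def by (meson order_trans)

lemma coverable_mono: "coverable \<epsilon> g \<Longrightarrow> (\<And>q. q \<in> M \<Longrightarrow> f q \<le> g q) \<Longrightarrow> coverable \<epsilon> f"
  unfolding coverable_def using covers_mono by blast

lemma cover_cost_mono:
  "coverable \<epsilon> g \<Longrightarrow> (\<And>q. q \<in> M \<Longrightarrow> f q \<le> g q) \<Longrightarrow> cover_cost \<epsilon> f \<le> cover_cost \<epsilon> g"
  by (intro cover_cost_greatest) (auto intro!: cover_cost_le intro: covers_mono)

lemma cover_cost_cong:
  assumes "\<And>q. q \<in> M \<Longrightarrow> f q = g q"
  shows "cover_cost \<epsilon> f = cover_cost \<epsilon> g"
  unfolding cover_cost_def covers_def using assms by simp

lemma covers_add: "covers \<epsilon> f xs \<Longrightarrow> covers \<epsilon> g ys \<Longrightarrow> covers \<epsilon> (\<lambda>q. f q + g q) (xs @ ys)"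
  unfolding covers_def pile_def by (auto intro: add_mono)

lemma coverable_add: "coverable \<epsilon> f \<Longrightarrow> coverable \<epsilon> g \<Longrightarrow> coverable \<epsilon> (\<lambda>q. f q + g q)"
  unfolding coverable_def using covers_add by blast

lemma cover_cost_add_le:
  assumes f: "coverable \<epsilon> f" and g: "coverable \<epsilon> g"
  shows "cover_cost \<epsilon> (\<lambda>q. f q + g q) \<le> cover_cost \<epsilon> f + cover_cost \<epsilon> g"
proof -
  have "cover_cost \<epsilon> (\<lambda>q. f q + g q) - cover_cost \<epsilon> g \<le> weight xs" if xs: "covers \<epsilon> f xs" for xs
  proof -
    have "cover_cost \<epsilon> (\<lambda>q. f q + g q) - weight xs \<le> weight ys" if ys: "covers \<epsilon> g ys" for ys
      using cover_cost_le[OF covers_add[OF xs ys]] by simp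
    then have "cover_cost \<epsilon> (\<lambda>q. f q + g q) - weight xs \<le> cover_cost \<epsilon> g"
      by (rule cover_cost_greatest[OF g])
    then show ?thesis
      by simp
  qed
  then have "cover_cost \<epsilon> (\<lambda>q. f q + g q) - cover_cost \<epsilon> g \<le> cover_cost \<epsilon> f"
    by (rule cover_cost_greatest[OF f])
  then show ?thesis
    by simp
qed

text \<open>
Multiplying the covered function by \<open>\<rho>\<close> is compensated by multiplying the weight of each ball by a
bound for \<open>\<rho>\<close> on that ball.
\<close>

lemma covers_reweight:
  assumes xs: "covers \<epsilon> f xs"
    and \<rho>: "\<And>q. q \<in> M \<Longrightarrow> 0 \<le> \<rho> q" and \<sigma>: "\<And>i. i \<in> M \<Longrightarrow> 0 \<le> \<sigma> i"
    and le: "\<And>i q. i \<in> M \<Longrightarrow> q \<in> M \<Longrightarrow> d i q < \<epsilon> \<Longrightarrow> \<rho> q \<le> \<sigma> i"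
  shows "covers \<epsilon> (\<lambda>q. \<rho> q * f q) (map (\<lambda>(c, i). (c * \<sigma> i, i)) xs)"
proof -
  have "\<rho> q * f q \<le> pile \<epsilon> (map (\<lambda>(c, i). (c * \<sigma> i, i)) xs) q" if q: "q \<in> M" for q
  proof -
    have "\<rho> q * f q \<le> \<rho> q * pile \<epsilon> xs q"
      using xs q \<rho> by (auto simp: covers_def intro: mult_left_mono)
    also have "\<dots> = (\<Sum>(c, i)\<leftarrow>xs. \<rho> q * (if d i q < \<epsilon> then c else 0))"
      by (simp add: pile_def sum_list_const_mult[symmetric] case_prod_unfold)
    also have "\<dots> \<le> (\<Sum>(c, i)\<leftarrow>xs. if d i q < \<epsilon> then c * \<sigma> i else 0)"
    proof (rule sum_list_mono, clarify)
      fix c i assume "(c, i) \<in> set xs"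
      then have "0 \<le> c" "i \<in> M"
        using xs by (auto simp: covers_def)
      then show "\<rho> q * (if d i q < \<epsilon> then c else 0) \<le> (if d i q < \<epsilon> then c * \<sigma> i else 0)"
        using le[of i q] q by (simp add: mult.commute mult_left_mono)
    qed
    also have "\<dots> = pile \<epsilon> (map (\<lambda>(c, i). (c * \<sigma> i, i)) xs) q"
      by (simp add: pile_def o_def case_prod_unfold cong: if_cong)
    finally show ?thesis .
  qed
  then show ?thesis
    using xs \<sigma> by (auto simp: covers_def)
qed

lemma weight_reweight: "weight (map (\<lambda>(c, i). (c * \<sigma> i, i)) xs) = (\<Sum>(c, i)\<leftarrow>xs. c * \<sigma> i)"
  by (simp add: o_def case_prod_unfold)

lemma coverable_scale:
  assumes "coverable \<epsilon> g" "0 \<le> (a::real)"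
  shows "coverable \<epsilon> (\<lambda>q. a * g q)"
  using assms covers_reweight[of \<epsilon> g _ "\<lambda>_. a" "\<lambda>_. a"] unfolding coverable_def by blast

lemma cover_cost_scale_le:
  assumes "coverable \<epsilon> g" "0 \<le> a"
  shows "cover_cost \<epsilon> (\<lambda>q. a * g q) \<le> a * cover_cost \<epsilon> g"
proof -
  have *: "cover_cost \<epsilon> (\<lambda>q. a * g q) \<le> a * weight xs" if "covers \<epsilon> g xs" for xs
  proof -
    have "cover_cost \<epsilon> (\<lambda>q. a * g q) \<le> weight (map (\<lambda>(c, i). (c * a, i)) xs)"
      using covers_reweight[OF that, of "\<lambda>_. a" "\<lambda>_. a"] assms by (intro cover_cost_le) auto
    also have "\<dots> = a * weight xs"
      by (simp add: o_def case_prod_unfold sum_list_const_mult mult.commute)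
    finally show ?thesis .
  qed
  show ?thesis
  proof (cases "a = 0")
    case True
    then show ?thesis
      using * assms by (auto simp: coverable_def)
  next
    case False
    then have "cover_cost \<epsilon> (\<lambda>q. a * g q) / a \<le> cover_cost \<epsilon> g"
      using * assms by (intro cover_cost_greatest) (auto simp: field_simps)
    then show ?thesis
      using False assms by (simp add: field_simps)
  qed
qed

lemma cover_cost_scale:
  assumes "coverable \<epsilon> g" "0 < a"
  shows "cover_cost \<epsilon> (\<lambda>q. a * g q) = a * cover_cost \<epsilon> g"
proof (rule antisym)
  show "cover_cost \<epsilon> (\<lambda>q. a * g q) \<le> a * cover_cost \<epsilon> g"
    using assms by (intro cover_cost_scale_le) auto
  have "cover_cost \<epsilon> (\<lambda>q. (1 / a) * (a * g q)) \<le> (1 / a) * cover_cost \<epsilon> (\<lambda>q. a * g q)"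
    using assms by (intro cover_cost_scale_le coverable_scale) auto
  then show "a * cover_cost \<epsilon> g \<le> cover_cost \<epsilon> (\<lambda>q. a * g q)"
    using assms by (simp add: field_simps)
qed

lemma cover_cost_sum_le:
  assumes "finite I" "I \<noteq> {}" "\<And>i. i \<in> I \<Longrightarrow> coverable \<epsilon> (f i)"
  shows "coverable \<epsilon> (\<lambda>q. \<Sum>i\<in>I. f i q) \<and>
    cover_cost \<epsilon> (\<lambda>q. \<Sum>i\<in>I. f i q) \<le> (\<Sum>i\<in>I. cover_cost \<epsilon> (f i))"
  using assms
proof (induction rule: finite_ne_induct)
  case (insert i I)
  then have "cover_cost \<epsilon> (\<lambda>q. f i q + (\<Sum>i\<in>I. f i q)) \<le>
    cover_cost \<epsilon> (f i) + cover_cost \<epsilon> (\<lambda>q. \<Sum>i\<in>I. f i q)"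
    by (intro cover_cost_add_le) auto
  with insert show ?case
    by (auto intro!: coverable_add)
qed auto

lemma covers_isometry:
  assumes h: "similarity 1 h" and xs: "covers \<epsilon> g xs"
  obtains ys where "covers \<epsilon> (\<lambda>q. g (h q)) ys" "weight ys = weight xs"
proof -
  obtain k where k: "similarity 1 k" "\<And>x. x \<in> M \<Longrightarrow> h (k x) = x"
    by (rule isometry_inverse[OF h]) blast
  have *: "d (k i) q = d i (h q)" if "i \<in> M" "q \<in> M" for i q
    using similarityD(4)[OF h, of "k i" q] similarityD(3)[OF k(1)] k(2) that by simp
  have "pile \<epsilon> (map (\<lambda>(c, i). (c, k i)) xs) q = pile \<epsilon> xs (h q)" if "q \<in> M" for q
    unfolding pile_def map_map using xs * that
    by (intro arg_cong[where f = sum_list] map_cong) (auto simp: covers_def)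
  then have "covers \<epsilon> (\<lambda>q. g (h q)) (map (\<lambda>(c, i). (c, k i)) xs)"
    using xs similarityD(3)[OF k(1)] similarityD(3)[OF h] by (auto simp: covers_def)
  then show thesis
    by (rule that) (simp add: o_def case_prod_unfold)
qed

lemma coverable_isometry: "similarity 1 h \<Longrightarrow> coverable \<epsilon> g \<Longrightarrow> coverable \<epsilon> (\<lambda>q. g (h q))"
  unfolding coverable_def using covers_isometry by metis

lemma cover_cost_isometry:
  assumes h: "similarity 1 h" and g: "coverable \<epsilon> g"
  shows "cover_cost \<epsilon> (\<lambda>q. g (h q)) = cover_cost \<epsilon> g"
proof -
  have le: "cover_cost \<epsilon> (\<lambda>q. f (k q)) \<le> cover_cost \<epsilon> f" if k: "similarity 1 k" "coverable \<epsilon> f" for k f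
  proof (rule cover_cost_greatest[OF k(2)])
    fix xs assume "covers \<epsilon> f xs"
    then obtain ys where "covers \<epsilon> (\<lambda>q. f (k q)) ys" "weight ys = weight xs"
      by (rule covers_isometry[OF k(1)])
    then show "cover_cost \<epsilon> (\<lambda>q. f (k q)) \<le> weight xs"
      using cover_cost_le by metis
  qed
  obtain k where k: "similarity 1 k" "\<And>x. x \<in> M \<Longrightarrow> h (k x) = x"
    by (rule isometry_inverse[OF h]) blast
  have "cover_cost \<epsilon> g = cover_cost \<epsilon> (\<lambda>q. g (h (k q)))"
    using k(2) by (intro cover_cost_cong) simp
  also have "\<dots> \<le> cover_cost \<epsilon> (\<lambda>q. g (h q))"
    using le[OF k(1) coverable_isometry[OF h g]] .
  finally show ?thesis
    using le[OF h g] by simp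
qed

lemma cover_cost_ge_value:
  assumes "coverable \<epsilon> g" "q \<in> M"
  shows "g q \<le> cover_cost \<epsilon> g"
  using assms by (intro cover_cost_greatest) (auto simp: covers_def intro: order_trans[OF _ pile_le_weight[unfolded covers_def]])

text \<open>
The covering number is subadditive; for Lipschitz functions it is almost additive once the balls are
small. A cover of \<open>\<psi> (f + g)\<close> is split into a cover of \<open>\<psi> f\<close> and one of \<open>\<psi> g\<close> by
multiplying the weight of a ball with the value at its centre of \<open>f / (f + g)\<close> and \<open>g / (f + g)\<close>
respectively. These two values sum to one, and the error is the oscillation of the quotients on a ball.
The summand \<open>\<delta>\<close> in the denominator keeps the quotients Lipschitz.
\<close>

lemma cover_cost_add_ge:
  assumes eps: "0 < \<epsilon>" and \<delta>: "0 < \<delta>" and L: "0 \<le> L"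
    and \<psi>: "coverable \<epsilon> \<psi>" "\<And>q. q \<in> M \<Longrightarrow> 0 \<le> \<psi> q"
    and f: "\<And>q. q \<in> M \<Longrightarrow> 0 \<le> f q" "\<And>x y. x \<in> M \<Longrightarrow> y \<in> M \<Longrightarrow> \<bar>f x - f y\<bar> \<le> L * d x y"
    and g: "\<And>q. q \<in> M \<Longrightarrow> 0 \<le> g q" "\<And>x y. x \<in> M \<Longrightarrow> y \<in> M \<Longrightarrow> \<bar>g x - g y\<bar> \<le> L * d x y"
    and fg: "coverable \<epsilon> (\<lambda>q. \<psi> q * (f q + g q))"
  shows "cover_cost \<epsilon> (\<lambda>q. \<psi> q * f q) + cover_cost \<epsilon> (\<lambda>q. \<psi> q * g q) \<le>
    (1 + 6 * L * \<epsilon> / \<delta>) * (cover_cost \<epsilon> (\<lambda>q. \<psi> q * (f q + g q)) + \<delta> * cover_cost \<epsilon> \<psi>)"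
proof -
  define h where "h q = f q + g q + \<delta>" for q
  \<comment> \<open>A Lipschitz constant of \<open>f / h\<close> and \<open>g / h\<close>: the numerator contributes \<open>L\<close>, the denominator \<open>2 * L\<close>.\<close>
  define K where "K = 3 * L / \<delta>"
  have K: "0 \<le> K"
    using L \<delta> by (simp add: K_def)
  have hpos: "\<delta> \<le> h q" if "q \<in> M" for q
    using f(1) g(1) that by (simp add: h_def)
  have lip: "k q / h q \<le> k i / h i + K * \<epsilon>"
    if k: "\<And>q. q \<in> M \<Longrightarrow> 0 \<le> k q \<and> k q \<le> h q" "\<And>x y. x \<in> M \<Longrightarrow> y \<in> M \<Longrightarrow> \<bar>k x - k y\<bar> \<le> L * d x y"
      and i: "i \<in> M" and q: "q \<in> M" and iq: "d i q < \<epsilon>" for k i q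
  proof -
    have dist: "L * d i q \<le> L * \<epsilon>"
      using iq L by (simp add: mult_left_mono)
    have "\<bar>h q - h i\<bar> \<le> 2 * (L * \<epsilon>)"
      using f(2)[OF i q] g(2)[OF i q] dist unfolding h_def by linarith
    moreover have "\<bar>k q - k i\<bar> \<le> L * \<epsilon>"
      using k(2)[OF i q] dist by linarith
    ultimately have hk: "h i - h q \<le> 2 * (L * \<epsilon>)" "k q \<le> k i + L * \<epsilon>"
      by linarith+
    have pos: "0 < h i" "0 < h q" "\<delta> \<le> h q" "\<delta> \<le> h i"
      using hpos[OF i] hpos[OF q] \<delta> by auto
    have "k q / h q \<le> (k i + L * \<epsilon>) / h q"
      using hk pos by (simp add: divide_right_mono)
    also have "\<dots> = k i / h q + L * \<epsilon> / h q"
      by (simp add: add_divide_distrib)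
    also have "L * \<epsilon> / h q \<le> L * \<epsilon> / \<delta>"
      using pos L eps \<delta> by (intro divide_left_mono) auto
    also have "k i / h q = k i / h i + (k i / h i) * ((h i - h q) / h q)"
      using pos by (simp add: field_simps)
    also have "(k i / h i) * ((h i - h q) / h q) \<le> 1 * (2 * (L * \<epsilon>) / \<delta>)"
    proof -
      have "(k i / h i) * ((h i - h q) / h q) \<le> (k i / h i) * (2 * (L * \<epsilon>) / h q)"
        using k(1)[OF i] pos hk by (intro mult_left_mono divide_right_mono) auto
      also have "\<dots> \<le> 1 * (2 * (L * \<epsilon>) / \<delta>)"
        using k(1)[OF i] pos L eps \<delta> by (intro mult_mono divide_left_mono) (auto simp: divide_le_eq_1)
      finally show ?thesis .
    qed
    finally show ?thesis
      by (simp add: K_def add_divide_distrib[symmetric])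
  qed
  have main: "cover_cost \<epsilon> (\<lambda>q. \<psi> q * f q) + cover_cost \<epsilon> (\<lambda>q. \<psi> q * g q) \<le> (1 + 2 * K * \<epsilon>) * weight xs"
    if xs: "covers \<epsilon> (\<lambda>q. \<psi> q * h q) xs" for xs
  proof -
    define \<sigma> where "\<sigma> k i = k i / h i + K * \<epsilon>" for k :: "'a \<Rightarrow> real" and i
    have cov: "cover_cost \<epsilon> (\<lambda>q. \<psi> q * k q) \<le> (\<Sum>(c, i)\<leftarrow>xs. c * \<sigma> k i)"
      if k: "\<And>q. q \<in> M \<Longrightarrow> 0 \<le> k q \<and> k q \<le> h q" "\<And>x y. x \<in> M \<Longrightarrow> y \<in> M \<Longrightarrow> \<bar>k x - k y\<bar> \<le> L * d x y" for k
    proof -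
      have nn: "0 \<le> k q / h q" if "q \<in> M" for q
        using k(1)[OF that] hpos[OF that] \<delta> by simp
      have "covers \<epsilon> (\<lambda>q. k q / h q * (\<psi> q * h q)) (map (\<lambda>(c, i). (c * \<sigma> k i, i)) xs)"
      proof (rule covers_reweight[OF xs])
        show "0 \<le> \<sigma> k i" if "i \<in> M" for i
          using nn[OF that] K eps by (simp add: \<sigma>_def)
        show "k q / h q \<le> \<sigma> k i" if "i \<in> M" "q \<in> M" "d i q < \<epsilon>" for i q
          unfolding \<sigma>_def using lip[of k i q] k that by blast
      qed (use nn in auto)
      then have "cover_cost \<epsilon> (\<lambda>q. k q / h q * (\<psi> q * h q)) \<le> (\<Sum>(c, i)\<leftarrow>xs. c * \<sigma> k i)"
        using cover_cost_le[of \<epsilon> _ "map (\<lambda>(c, i). (c * \<sigma> k i, i)) xs"] by (simp only: weight_reweight)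
      moreover have "cover_cost \<epsilon> (\<lambda>q. k q / h q * (\<psi> q * h q)) = cover_cost \<epsilon> (\<lambda>q. \<psi> q * k q)"
        using hpos \<delta> by (intro cover_cost_cong) force
      ultimately show ?thesis
        by simp
    qed
    have "cover_cost \<epsilon> (\<lambda>q. \<psi> q * f q) + cover_cost \<epsilon> (\<lambda>q. \<psi> q * g q) \<le>
      (\<Sum>(c, i)\<leftarrow>xs. c * \<sigma> f i) + (\<Sum>(c, i)\<leftarrow>xs. c * \<sigma> g i)"
      using f g \<delta> by (intro add_mono cov) (auto simp: h_def add_nonneg_nonneg)
    also have "\<dots> = (\<Sum>(c, i)\<leftarrow>xs. c * \<sigma> f i + c * \<sigma> g i)"
      by (simp add: sum_list_addf case_prod_unfold)
    also have "\<dots> \<le> (\<Sum>(c, i)\<leftarrow>xs. (1 + 2 * K * \<epsilon>) * c)"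
    proof (rule sum_list_mono, clarify)
      fix c i assume "(c, i) \<in> set xs"
      then have ci: "0 \<le> c" "i \<in> M"
        using xs by (auto simp: covers_def)
      have "f i / h i + g i / h i \<le> 1"
        using hpos[OF ci(2)] \<delta> by (simp add: h_def add_divide_distrib[symmetric] divide_le_eq_1)
      then have "c * (\<sigma> f i + \<sigma> g i) \<le> c * (1 + 2 * K * \<epsilon>)"
        using ci by (intro mult_left_mono) (auto simp: \<sigma>_def)
      then show "c * \<sigma> f i + c * \<sigma> g i \<le> (1 + 2 * K * \<epsilon>) * c"
        by (simp add: algebra_simps)
    qed
    also have "\<dots> = (1 + 2 * K * \<epsilon>) * weight xs"
      by (simp add: sum_list_const_mult case_prod_unfold)
    finally show ?thesis .
  qed
  have h_eq: "(\<lambda>q. \<psi> q * h q) = (\<lambda>q. \<psi> q * (f q + g q) + \<delta> * \<psi> q)"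
    by (auto simp: h_def algebra_simps)
  have covh: "coverable \<epsilon> (\<lambda>q. \<psi> q * h q)"
    unfolding h_eq using fg \<psi> \<delta> by (intro coverable_add coverable_scale) auto
  have pos: "0 < 1 + 2 * K * \<epsilon>"
    using K eps by (simp add: add_pos_nonneg)
  have "(cover_cost \<epsilon> (\<lambda>q. \<psi> q * f q) + cover_cost \<epsilon> (\<lambda>q. \<psi> q * g q)) / (1 + 2 * K * \<epsilon>)
    \<le> cover_cost \<epsilon> (\<lambda>q. \<psi> q * h q)"
    using main pos by (intro cover_cost_greatest covh) (auto simp: divide_le_eq mult.commute)
  also have "\<dots> \<le> cover_cost \<epsilon> (\<lambda>q. \<psi> q * (f q + g q)) + cover_cost \<epsilon> (\<lambda>q. \<delta> * \<psi> q)"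
    unfolding h_eq using fg \<psi> \<delta> by (intro cover_cost_add_le coverable_scale) auto
  also have "cover_cost \<epsilon> (\<lambda>q. \<delta> * \<psi> q) \<le> \<delta> * cover_cost \<epsilon> \<psi>"
    using \<psi> \<delta> by (intro cover_cost_scale_le) auto
  finally show ?thesis
    using pos by (simp add: divide_le_eq K_def mult.commute algebra_simps)
qed

end

section \<open>Doubling, cutoffs and test functions in a homogeneous geodesic space\<close>

text \<open>
These are the consequences of the hypotheses of the theorem on which the rest of the argument is based.
\<close>

locale homogeneous_geodesic_space = Metric_space +
  assumes pair_transitive:
      "\<lbrakk>a \<in> M; b \<in> M; a \<noteq> b; a' \<in> M; b' \<in> M; a' \<noteq> b'\<rbrakk> \<Longrightarrow> \<exists>r u. similarity r u \<and> u a = a' \<and> u b = b'"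
    and between: "\<lbrakk>x \<in> M; z \<in> M; 0 \<le> t; t \<le> 1\<rbrakk> \<Longrightarrow> \<exists>y\<in>M. d x y = t * d x z \<and> d y z = (1 - t) * d x z"
    and balls_totally_bounded: "mtotally_bounded (mcball p r)"
    and two_points: "\<exists>x\<in>M. \<exists>y\<in>M. x \<noteq> y"
begin

text \<open>
Pairs are all alike: a point dividing \<open>x\<close> and \<open>y\<close> is moved to \<open>y\<close> by a dilation about \<open>x\<close>, and
the same dilation moves \<open>y\<close> to the point that extends the geodesic.
\<close>

lemma collinear_extension:
  assumes "x \<in> M" "y \<in> M" "x \<noteq> y" "0 < t" "t < 1"
  shows "\<exists>z\<in>M. d x y = t * d x z \<and> d y z = (1 - t) * d x z"
proof -
  obtain m where m: "m \<in> M" "d x m = t * d x y" "d m y = (1 - t) * d x y"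
    using between[of x y t] assms by auto
  then have "x \<noteq> m"
    using assms by (metis mdist_pos_eq mult_pos_pos less_irrefl mdist_zero)
  then obtain r u where u: "similarity r u" "u x = x" "u m = y"
    using pair_transitive[of x m x y] assms m by blast
  note uD = similarityD[OF u(1)]
  have "d x y = t * d x (u y)" "d y (u y) = (1 - t) * d x (u y)"
    using uD(4)[of x m] uD(4)[of x y] uD(4)[of m y] u m assms by (auto simp: mult.commute)
  then show ?thesis
    using uD(3) assms by blast
qed

lemma sphere_nonempty:
  assumes "p \<in> M" "0 \<le> r"
  shows "\<exists>q\<in>M. d p q = r"
proof -
  obtain e where e: "e \<in> M" "e \<noteq> p"
    using two_points by metis
  have far: "\<exists>q\<in>M. d p q = 2 ^ n * d p e" for n
  proof (induction n)
    case (Suc n)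
    then obtain q where q: "q \<in> M" "d p q = 2 ^ n * d p e"
      by blast
    moreover have "0 < d p e"
      using e assms by simp
    ultimately have "p \<noteq> q"
      using e assms by (metis mdist_zero mult_pos_pos zero_less_power zero_less_numeral less_irrefl)
    then obtain z where "z \<in> M" "d p q = 1 / 2 * d p z"
      using collinear_extension[of p q "1/2"] q assms by auto
    with q show ?case
      by (auto intro!: bexI[of _ z])
  qed (use e in auto)
  have dpe: "0 < d p e"
    using e assms by simp
  obtain n where "r / d p e < 2 ^ n"
    using real_arch_pow[of 2 "r / d p e"] by auto
  then have "r < 2 ^ n * d p e"
    using dpe by (simp add: divide_less_eq)
  moreover obtain q where q: "q \<in> M" "d p q = 2 ^ n * d p e"
    using far by blast
  ultimately have rq: "r < d p q"
    by simp
  then obtain y where "y \<in> M" "d p y = r / d p q * d p q"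
    using between[of p q "r / d p q"] assms q by (auto simp: divide_le_eq_1)
  then show ?thesis
    using rq assms by auto
qed

lemma isometry_on_pairs:
  assumes "a \<in> M" "b \<in> M" "a' \<in> M" "b' \<in> M" "a \<noteq> b" "d a b = d a' b'"
  obtains h where "similarity 1 h" "h a = a'" "h b = b'"
proof -
  have "a' \<noteq> b'"
    using assms by (metis mdist_pos_eq mdist_zero less_irrefl)
  then obtain r u where u: "similarity r u" "u a = a'" "u b = b'"
    using pair_transitive assms by blast
  then have "d a' b' = r * d a b"
    using similarityD(4)[OF u(1)] assms by metis
  then have "r = 1"
    using assms \<open>a' \<noteq> b'\<close> by simp
  with u that show thesis
    by blast
qed

lemma isometry_on_points:
  assumes "p \<in> M" "q \<in> M"
  obtains h where "similarity 1 h" "h p = q"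
proof -
  obtain p' where p': "p' \<in> M" "d p p' = 1"
    using sphere_nonempty[of p 1] assms by auto
  obtain q' where q': "q' \<in> M" "d q q' = 1"
    using sphere_nonempty[of q 1] assms by auto
  have "p \<noteq> p'"
    using p' assms by auto
  then show thesis
    using isometry_on_pairs[of p p' q q'] p' q' assms that by metis
qed

lemma dilation_about_point:
  assumes "p \<in> M" "0 < r"
  obtains u where "similarity r u" "u p = p"
proof -
  obtain x where x: "x \<in> M" "d p x = 1"
    using sphere_nonempty[of p 1] assms by auto
  obtain y where y: "y \<in> M" "d p y = r"
    using sphere_nonempty[of p r] assms by auto
  have "p \<noteq> x" "p \<noteq> y"
    using x y assms by auto
  then obtain s u where u: "similarity s u" "u p = p" "u x = y"
    using pair_transitive[of p x p y] x y assms by blast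
  then have "r = s * 1"
    using similarityD(4)[OF u(1), of p x] x y assms by simp
  with u that show thesis
    by simp
qed

lemma coverable_ball:
  assumes "0 < \<epsilon>"
  shows "coverable \<epsilon> (indicator (mcball p r))"
proof -
  obtain K where K: "finite K" "K \<subseteq> mcball p r" "mcball p r \<subseteq> (\<Union>x\<in>K. mball x \<epsilon>)"
    using balls_totally_bounded[of p r, unfolded mtotally_bounded_def, rule_format, OF assms] by blast
  obtain ks where ks: "set ks = K"
    using K(1) finite_list by blast
  have "covers \<epsilon> (indicator (mcball p r)) (map (\<lambda>i. (1, i)) ks)"
    unfolding covers_def
  proof (intro conjI ballI)
    show "case x of (c, i) \<Rightarrow> 0 \<le> c \<and> i \<in> M" if "x \<in> set (map (\<lambda>i. (1 :: real, i)) ks)" for x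
      using that ks K(2) by auto
    show "indicator (mcball p r) q \<le> pile \<epsilon> (map (\<lambda>i. (1, i)) ks) q" for q
    proof (cases "q \<in> mcball p r")
      case True
      then obtain k where k: "k \<in> set ks" "d k q < \<epsilon>"
        using K(3) ks by auto
      have "1 \<le> (\<Sum>i\<leftarrow>ks. if d i q < \<epsilon> then 1 else 0 :: real)"
        using member_le_sum_list[of "1::real" "map (\<lambda>i. if d i q < \<epsilon> then 1 else 0) ks"] k by force
      then show ?thesis
        using True by (simp add: pile_def o_def)
    next
      case False
      then show ?thesis
        by (auto simp: pile_def o_def intro!: sum_list_nonneg)
    qed
  qed
  then show ?thesis
    unfolding coverable_def by blast
qed

lemma coverable_bounded:
  assumes "0 < \<epsilon>" "0 \<le> C" "\<And>q. q \<in> M \<Longrightarrow> g q \<le> C * indicator (mcball p r) q"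
  shows "coverable \<epsilon> g"
  using coverable_mono[OF coverable_scale[OF coverable_ball[OF assms(1)] assms(2)] assms(3)] .

lemma cover_cost_ball_eq:
  assumes "p \<in> M" "q \<in> M" "0 < \<epsilon>"
  shows "cover_cost \<epsilon> (indicator (mcball p r)) = cover_cost \<epsilon> (indicator (mcball q r))"
proof -
  obtain h where h: "similarity 1 h" "h p = q"
    using isometry_on_points assms by blast
  have "cover_cost \<epsilon> (indicator (mcball p r)) = cover_cost \<epsilon> (\<lambda>x. indicator (mcball q r) (h x))"
    using similarityD[OF h(1)] h(2) assms by (intro cover_cost_cong) (force simp: indicator_def)
  also have "\<dots> = cover_cost \<epsilon> (indicator (mcball q r))"
    by (intro cover_cost_isometry h coverable_ball assms)
  finally show ?thesis .
qed

text \<open>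
The constant \<open>m\<close> is independent of \<open>N\<close> and \<open>\<epsilon>\<close>: the ball of radius \<open>4\<close> is covered by finitely many
balls of radius \<open>1 / 4\<close>, dilations about \<open>p\<close> transport this cover to every scale \<open>N\<close>, and
all balls of equal radius have equal covering number by homogeneity.
\<close>

lemma cover_cost_doubling:
  assumes p: "p \<in> M"
  obtains m where "m > 0" "\<And>N \<epsilon>. 0 < N \<Longrightarrow> 0 < \<epsilon> \<Longrightarrow>
    cover_cost \<epsilon> (indicator (mcball p (4 * N))) \<le> m * cover_cost \<epsilon> (indicator (mcball p (N / 4)))"
proof -
  obtain K where K: "finite K" "K \<subseteq> mcball p 4" "mcball p 4 \<subseteq> (\<Union>x\<in>K. mball x (1 / 4))"
    using balls_totally_bounded[of p 4, unfolded mtotally_bounded_def, rule_format, of "1 / 4"] by auto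
  have "p \<in> mcball p 4"
    using p by simp
  then have "K \<noteq> {}"
    using K(3) by blast
  have "cover_cost \<epsilon> (indicator (mcball p (4 * N))) \<le> card K * cover_cost \<epsilon> (indicator (mcball p (N / 4)))"
    if N: "0 < N" and \<epsilon>: "0 < \<epsilon>" for N \<epsilon>
  proof -
    obtain u where u: "similarity N u" "u p = p"
      using dilation_about_point p N by blast
    note uD = similarityD[OF u(1)]
    have KM: "k \<in> M" if "k \<in> K" for k
      using that K(2) by auto
    have sum: "coverable \<epsilon> (\<lambda>q. \<Sum>k\<in>K. indicator (mcball (u k) (N / 4)) q) \<and>
      cover_cost \<epsilon> (\<lambda>q. \<Sum>k\<in>K. indicator (mcball (u k) (N / 4)) q) \<le>
      (\<Sum>k\<in>K. cover_cost \<epsilon> (indicator (mcball (u k) (N / 4))))"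
      by (intro cover_cost_sum_le K \<open>K \<noteq> {}\<close> coverable_ball \<epsilon>)
    have le: "indicator (mcball p (4 * N)) q \<le> (\<Sum>k\<in>K. indicator (mcball (u k) (N / 4)) q :: real)" if "q \<in> M" for q
    proof (cases "q \<in> mcball p (4 * N)")
      case True
      obtain x where x: "x \<in> M" "u x = q"
        using \<open>q \<in> M\<close> bij_betw_imp_surj_on[OF uD(2)] by (metis imageE)
      then have "N * d p x \<le> N * 4"
        using True uD(4)[of p x] u p by simp
      then have "x \<in> mcball p 4"
        using N x p by simp
      then obtain k where k: "k \<in> K" "d k x < 1 / 4"
        using K(3) by auto
      then have "d (u k) q \<le> N / 4"
        using uD(4)[of k x] x KM[OF k(1)] mult_strict_left_mono[OF k(2) N] by simp
      then have "indicator (mcball (u k) (N / 4)) q = (1::real)"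
        using uD(3) KM k(1) \<open>q \<in> M\<close> by simp
      then show ?thesis
        using member_le_sum[of k K "\<lambda>k. indicator (mcball (u k) (N / 4)) q :: real"] k K(1)
        by (simp add: indicator_def split: if_splits)
    qed (auto intro: sum_nonneg)
    have "cover_cost \<epsilon> (indicator (mcball p (4 * N))) \<le> (\<Sum>k\<in>K. cover_cost \<epsilon> (indicator (mcball (u k) (N / 4))))"
      using cover_cost_mono[OF conjunct1[OF sum] le] conjunct2[OF sum] by linarith
    also have "\<dots> = (\<Sum>k\<in>K. cover_cost \<epsilon> (indicator (mcball p (N / 4))))"
      using KM uD(3) p \<epsilon> by (intro sum.cong cover_cost_ball_eq) auto
    finally show ?thesis
      by simp
  qed
  moreover have "0 < real (card K)"
    using K(1) \<open>K \<noteq> {}\<close> by (simp add: card_gt_0_iff)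
  ultimately show thesis
    using that by blast
qed

text \<open>
The cutoff decreases from \<open>1\<close> to \<open>0\<close> between the radii \<open>2 * N\<close> and \<open>3 * N\<close>. Its slope
\<open>1 / N\<close> is what makes averages over it almost invariant under a fixed isometry when \<open>N\<close> is large.
\<close>

definition cutoff :: "'a \<Rightarrow> real \<Rightarrow> 'a \<Rightarrow> real" where
  "cutoff p N q = max 0 (min 1 (3 - d p q / N))"

lemma cutoff_bounds:
  assumes "p \<in> M" "q \<in> M" "0 < N"
  shows "0 \<le> cutoff p N q" "cutoff p N q \<le> indicator (mcball p (3 * N)) q"
    "indicator (mcball p (2 * N)) q \<le> cutoff p N q"
  using assms by (auto simp: cutoff_def indicator_def field_simps)

definition test_function :: "('a \<Rightarrow> real) \<Rightarrow> bool" where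
  "test_function g \<longleftrightarrow> (\<exists>C. \<forall>q\<in>M. 0 \<le> g q \<and> g q \<le> C) \<and>
     (\<exists>L\<ge>0. \<forall>x\<in>M. \<forall>y\<in>M. \<bar>g x - g y\<bar> \<le> L * d x y)"

lemma test_function_add:
  assumes "test_function f" "test_function g"
  shows "test_function (\<lambda>q. f q + g q)"
proof -
  obtain C L C' L' where f: "\<And>q. q \<in> M \<Longrightarrow> 0 \<le> f q \<and> f q \<le> C" "L \<ge> 0"
      "\<And>x y. x \<in> M \<Longrightarrow> y \<in> M \<Longrightarrow> \<bar>f x - f y\<bar> \<le> L * d x y"
    and g: "\<And>q. q \<in> M \<Longrightarrow> 0 \<le> g q \<and> g q \<le> C'" "L' \<ge> 0"
      "\<And>x y. x \<in> M \<Longrightarrow> y \<in> M \<Longrightarrow> \<bar>g x - g y\<bar> \<le> L' * d x y"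
    using assms unfolding test_function_def by metis
  have "0 \<le> f q + g q \<and> f q + g q \<le> C + C'" if "q \<in> M" for q
    using f(1)[OF that] g(1)[OF that] by simp
  moreover have "\<bar>(f x + g x) - (f y + g y)\<bar> \<le> (L + L') * d x y" if "x \<in> M" "y \<in> M" for x y
    using f(3)[OF that] g(3)[OF that] by (simp add: distrib_right)
  moreover have "0 \<le> L + L'"
    using f(2) g(2) by simp
  ultimately show ?thesis
    unfolding test_function_def by blast
qed

lemma test_function_scale:
  assumes "test_function f" "0 \<le> (a::real)"
  shows "test_function (\<lambda>q. a * f q)"
proof -
  obtain C L where f: "\<And>q. q \<in> M \<Longrightarrow> 0 \<le> f q \<and> f q \<le> C" "L \<ge> 0"
      "\<And>x y. x \<in> M \<Longrightarrow> y \<in> M \<Longrightarrow> \<bar>f x - f y\<bar> \<le> L * d x y"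
    using assms unfolding test_function_def by metis
  have "0 \<le> a * f q \<and> a * f q \<le> a * C" if "q \<in> M" for q
    using f(1)[OF that] assms by (simp add: mult_left_mono)
  moreover have "\<bar>a * f x - a * f y\<bar> \<le> (a * L) * d x y" if "x \<in> M" "y \<in> M" for x y
    using mult_left_mono[OF f(3)[OF that] assms(2)] assms(2)
    by (simp add: abs_mult mult.assoc flip: right_diff_distrib)
  moreover have "0 \<le> a * L"
    using f(2) assms by simp
  ultimately show ?thesis
    unfolding test_function_def by blast
qed

lemma test_function_isometry:
  assumes "test_function f" "similarity 1 h"
  shows "test_function (\<lambda>q. f (h q))"
  using assms similarityD[OF assms(2)] unfolding test_function_def by (metis mult_1)

lemma test_function_dist_diff:
  assumes "a \<in> M" "b \<in> M"
  shows "test_function (\<lambda>q. (d q a - d q b)\<^sup>2)"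
proof -
  have le: "\<bar>d q a - d q b\<bar> \<le> d a b" if "q \<in> M" for q
    using mdist_reverse_triangle[of a q b] assms that by (simp add: commute)
  have "0 \<le> (d q a - d q b)\<^sup>2 \<and> (d q a - d q b)\<^sup>2 \<le> (d a b)\<^sup>2" if "q \<in> M" for q
    using power_mono[OF le[OF that], of 2] by simp
  moreover have "\<bar>(d x a - d x b)\<^sup>2 - (d y a - d y b)\<^sup>2\<bar> \<le> (4 * d a b) * d x y" if "x \<in> M" "y \<in> M" for x y
  proof -
    have "\<bar>(d x a - d x b) + (d y a - d y b)\<bar> \<le> 2 * d a b"
      using le[OF that(1)] le[OF that(2)] by linarith
    moreover have "\<bar>(d x a - d x b) - (d y a - d y b)\<bar> \<le> 2 * d x y"
      using mdist_reverse_triangle[of x a y] mdist_reverse_triangle[of x b y] assms that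
      by (simp add: commute)
    ultimately have "\<bar>(d x a - d x b) + (d y a - d y b)\<bar> * \<bar>(d x a - d x b) - (d y a - d y b)\<bar>
      \<le> (2 * d a b) * (2 * d x y)"
      by (intro mult_mono) auto
    then show ?thesis
      by (simp add: abs_mult[symmetric] power2_eq_square algebra_simps)
  qed
  ultimately show ?thesis
    unfolding test_function_def using nonneg[of a b] by (metis mult_nonneg_nonneg zero_le_numeral)
qed

end

section \<open>An isometry-invariant mean\<close>

context homogeneous_geodesic_space
begin

lemma test_function_coverable:
  assumes p: "p \<in> M" and N: "0 < N" and \<epsilon>: "0 < \<epsilon>" and g: "test_function g"
  shows "coverable \<epsilon> (\<lambda>q. cutoff p N q * g q)"
proof -
  obtain C where C: "\<And>q. q \<in> M \<Longrightarrow> 0 \<le> g q \<and> g q \<le> C"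
    using g unfolding test_function_def by metis
  have "0 \<le> C"
    using C[OF p] by linarith
  show ?thesis
  proof (rule coverable_bounded[OF \<epsilon> \<open>0 \<le> C\<close>])
    fix q assume q: "q \<in> M"
    have "cutoff p N q * g q \<le> indicator (mcball p (3 * N)) q * C"
      using cutoff_bounds[OF p q N] C[OF q] by (intro mult_mono) auto
    then show "cutoff p N q * g q \<le> C * indicator (mcball p (3 * N)) q"
      by (simp add: mult.commute)
  qed
qed

lemma cutoff_coverable:
  assumes "p \<in> M" "0 < N" "0 < \<epsilon>"
  shows "coverable \<epsilon> (cutoff p N)"
  using coverable_mono[OF coverable_ball[OF assms(3)] cutoff_bounds(2)[OF assms(1) _ assms(2)]] .

lemma cutoff_cost_ge_1:
  assumes p: "p \<in> M" and N: "0 < N" and \<epsilon>: "0 < \<epsilon>"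
  shows "1 \<le> cover_cost \<epsilon> (cutoff p N)"
  using cover_cost_ge_value[OF cutoff_coverable[OF p N \<epsilon>] p] p by (simp add: cutoff_def)

text \<open>
An isometry \<open>h\<close> shifts the cutoff by at most the distance from \<open>p\<close> to \<open>h p\<close>, hence changes its
values by at most that distance divided by \<open>N\<close>, and only within the ball of radius \<open>4 * N\<close>.
\<close>

lemma cover_cost_almost_invariant:
  assumes p: "p \<in> M" and h: "similarity 1 h" and N: "0 < N" "d p (h p) \<le> N" and \<epsilon>: "0 < \<epsilon>"
    and g: "test_function g" and C: "0 \<le> C" "\<And>q. q \<in> M \<Longrightarrow> g q \<le> C"
  shows "cover_cost \<epsilon> (\<lambda>q. cutoff p N q * g (h q)) \<le> cover_cost \<epsilon> (\<lambda>q. cutoff p N q * g q)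
    + d p (h p) / N * C * cover_cost \<epsilon> (indicator (mcball p (4 * N)))"
proof -
  define D where "D = d p (h p)"
  note hD = similarityD[OF h]
  have "0 \<le> D"
    by (simp add: D_def)
  have gnn: "0 \<le> g q" if "q \<in> M" for q
    using g that unfolding test_function_def by blast
  let ?F = "\<lambda>q. cutoff p N q * g q + D / N * C * indicator (mcball p (4 * N)) q"
  have F: "coverable \<epsilon> ?F"
    using p N \<epsilon> g C \<open>0 \<le> D\<close>
    by (intro coverable_add test_function_coverable coverable_scale coverable_ball) auto
  have le: "cutoff p N q * g (h q) \<le> ?F (h q)" if q: "q \<in> M" for q
  proof -
    have hq: "h q \<in> M" and hp: "h p \<in> M"
      using hD q p by auto
    have "d p (h q) \<le> d p (h p) + d (h p) (h q)"
      using triangle[OF p hp hq] .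
    then have dist: "d p (h q) \<le> D + d p q"
      using hD(4)[OF p q] by (simp add: D_def)
    have "cutoff p N q \<le> cutoff p N (h q) + D / N * indicator (mcball p (4 * N)) (h q)"
    proof (cases "d p q \<le> 3 * N")
      case True
      then have "indicator (mcball p (4 * N)) (h q) = (1 :: real)"
        using dist N(2) p hq by (simp add: D_def)
      moreover have "d p (h q) / N \<le> D / N + d p q / N"
        using dist N by (simp add: divide_right_mono flip: add_divide_distrib)
      moreover have "0 \<le> D / N"
        using \<open>0 \<le> D\<close> N by simp
      ultimately show ?thesis
        by (simp add: cutoff_def)
    next
      case False
      then have "cutoff p N q \<le> 0"
        using cutoff_bounds(2)[OF p q N(1)] by (simp add: indicator_def)
      then show ?thesis
        using cutoff_bounds(1)[OF p hq N(1)] \<open>0 \<le> D\<close> N(1) by (smt (verit) divide_nonneg_pos indicator_pos_le mult_nonneg_nonneg)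
    qed
    then have "cutoff p N q * g (h q) \<le> (cutoff p N (h q) + D / N * indicator (mcball p (4 * N)) (h q)) * g (h q)"
      using gnn[OF hq] by (rule mult_right_mono)
    also have "\<dots> = cutoff p N (h q) * g (h q) + (D / N * indicator (mcball p (4 * N)) (h q)) * g (h q)"
      by (simp add: distrib_right)
    also have "(D / N * indicator (mcball p (4 * N)) (h q)) * g (h q) \<le> (D / N * indicator (mcball p (4 * N)) (h q)) * C"
      using C(2)[OF hq] \<open>0 \<le> D\<close> N by (intro mult_left_mono) auto
    finally show ?thesis
      by (simp add: mult.commute mult.left_commute)
  qed
  have "cover_cost \<epsilon> (\<lambda>q. cutoff p N q * g (h q)) \<le> cover_cost \<epsilon> (\<lambda>q. ?F (h q))"
    by (rule cover_cost_mono[OF coverable_isometry[OF h F] le])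
  also have "\<dots> = cover_cost \<epsilon> ?F"
    by (rule cover_cost_isometry[OF h F])
  also have "\<dots> \<le> cover_cost \<epsilon> (\<lambda>q. cutoff p N q * g q) + cover_cost \<epsilon> (\<lambda>q. D / N * C * indicator (mcball p (4 * N)) q)"
    using p N \<epsilon> g C \<open>0 \<le> D\<close>
    by (intro cover_cost_add_le test_function_coverable coverable_scale coverable_ball) auto
  also have "cover_cost \<epsilon> (\<lambda>q. D / N * C * indicator (mcball p (4 * N)) q)
    \<le> D / N * C * cover_cost \<epsilon> (indicator (mcball p (4 * N)))"
    using N \<epsilon> C \<open>0 \<le> D\<close> by (intro cover_cost_scale_le coverable_ball) auto
  finally show ?thesis
    by (simp add: D_def)
qed

lemma unit_chain:
  assumes "a \<in> M" "b \<in> M" "d a b = real n"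
  obtains x :: "nat \<Rightarrow> 'a" where "x 0 = a" "x n = b" "\<And>i. i \<le> n \<Longrightarrow> x i \<in> M \<and> d a (x i) \<le> real i"
    "\<And>i. i < n \<Longrightarrow> d (x i) (x (Suc i)) = 1"
proof -
  have "\<exists>x :: nat \<Rightarrow> 'a. x 0 = a \<and> x n = b \<and> (\<forall>i\<le>n. x i \<in> M \<and> d a (x i) \<le> real i) \<and>
      (\<forall>i<n. d (x i) (x (Suc i)) = 1)"
    using assms(2,3)
  proof (induction n arbitrary: b)
    case 0
    then show ?case
      using assms(1) by (intro exI[of _ "\<lambda>_. a"]) auto
  next
    case (Suc n)
    obtain y where y: "y \<in> M" "d a y = real n / real (Suc n) * d a b" "d y b = (1 - real n / real (Suc n)) * d a b"
      using between[of a b "real n / real (Suc n)"] Suc.prems assms(1) by auto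
    have yb: "d a y = real n" "d y b = 1"
      unfolding y Suc.prems by (auto simp: field_simps)
    obtain x :: "nat \<Rightarrow> 'a" where x: "x 0 = a" "x n = y" "\<forall>i\<le>n. x i \<in> M \<and> d a (x i) \<le> real i"
        "\<forall>i<n. d (x i) (x (Suc i)) = 1"
      using Suc.IH[OF y(1) yb(1)] by blast
    show ?case
      using x yb Suc.prems
      by (intro exI[of _ "x(Suc n := b)"]) (auto simp: le_Suc_eq less_Suc_eq)
  qed
  then show thesis
    using that by blast
qed

text \<open>
Let \<open>y\<close> be at distance \<open>n\<close> from \<open>p\<close>. For \<open>q\<close> within distance \<open>n / 4\<close> of \<open>p\<close> the distances
to \<open>p\<close> and to \<open>y\<close> differ by at least \<open>n / 2\<close>. This difference is a sum over a chain of \<open>n\<close> unit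
steps from \<open>p\<close> to \<open>y\<close>, so by Cauchy-Schwarz the steps contribute on average at least \<open>1 / 4\<close> in mean
square. An isometry carries each step to the pair of \<open>p\<close> and \<open>e\<close>; it moves \<open>p\<close> by at most \<open>n\<close>, so
that the image of the small ball stays where the cutoff equals \<open>1\<close>.
\<close>

lemma cover_cost_lower_bound:
  assumes p: "p \<in> M" and e: "e \<in> M" "d p e = 1" and n: "0 < n" and \<epsilon>: "0 < \<epsilon>"
  shows "cover_cost \<epsilon> (indicator (mcball p (real n / 4))) \<le>
    4 * cover_cost \<epsilon> (\<lambda>q. cutoff p (real n) q * (d q p - d q e)\<^sup>2)"
proof -
  define N where "N = real n"
  have N: "0 < N"
    using n by (simp add: N_def)
  let ?B = "indicator (mcball p (N / 4)) :: 'a \<Rightarrow> real"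
  let ?G = "\<lambda>q. cutoff p N q * (d q p - d q e)\<^sup>2"
  obtain y where y: "y \<in> M" "d p y = real n"
    using sphere_nonempty[of p "real n"] p by auto
  obtain x :: "nat \<Rightarrow> 'a" where x: "x 0 = p" "x n = y" "\<And>i. i \<le> n \<Longrightarrow> x i \<in> M \<and> d p (x i) \<le> real i"
      "\<And>i. i < n \<Longrightarrow> d (x i) (x (Suc i)) = 1"
    using unit_chain[OF p y] by metis
  have G: "coverable \<epsilon> ?G"
    using p e N \<epsilon> by (intro test_function_coverable test_function_dist_diff)
  define f where "f i q = d q (x i) - d q (x (Suc i))" for i q
  have step: "coverable \<epsilon> (\<lambda>q. ?B q * (f i q)\<^sup>2) \<and> cover_cost \<epsilon> (\<lambda>q. ?B q * (f i q)\<^sup>2) \<le> cover_cost \<epsilon> ?G"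
    if i: "i < n" for i
  proof -
    have xi: "x i \<in> M" "x (Suc i) \<in> M" "d (x i) (x (Suc i)) = 1" "d p (x i) \<le> N"
      using x(3)[of i] x(3)[of "Suc i"] x(4)[of i] i by (auto simp: N_def)
    then have "x i \<noteq> x (Suc i)"
      by auto
    then obtain h where h: "similarity 1 h" "h (x i) = p" "h (x (Suc i)) = e"
      using isometry_on_pairs[of "x i" "x (Suc i)" p e] xi p e by auto
    note hD = similarityD[OF h(1)]
    have le: "?B q * (f i q)\<^sup>2 \<le> ?G (h q)" if q: "q \<in> M" for q
    proof -
      have "f i q = d (h q) p - d (h q) e"
        using hD(4)[OF q xi(1)] hD(4)[OF q xi(2)] h by (simp add: f_def)
      moreover have "?B q \<le> cutoff p N (h q)"
      proof (cases "q \<in> mcball p (N / 4)")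
        case True
        have "d p (h q) = d (x i) q"
          using hD(4)[OF xi(1) q] h by simp
        also have "\<dots> \<le> d p (x i) + d p q"
          using triangle[of "x i" p q] xi p q by (simp add: commute)
        also have "\<dots> \<le> 2 * N"
          using True xi(4) N by simp
        finally have "indicator (mcball p (2 * N)) (h q) = (1 :: real)"
          using hD(3)[OF q] p by simp
        then show ?thesis
          using cutoff_bounds(3)[OF p hD(3)[OF q] N] True by simp
      qed (use cutoff_bounds(1)[OF p hD(3)[OF q] N] in auto)
      ultimately show ?thesis
        by (simp add: mult_right_mono)
    qed
    have Gh: "coverable \<epsilon> (\<lambda>q. ?G (h q))"
      using coverable_isometry[OF h(1) G] .
    have "cover_cost \<epsilon> (\<lambda>q. ?B q * (f i q)\<^sup>2) \<le> cover_cost \<epsilon> (\<lambda>q. ?G (h q))"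
      by (rule cover_cost_mono[OF Gh le])
    also have "\<dots> = cover_cost \<epsilon> ?G"
      by (rule cover_cost_isometry[OF h(1) G])
    finally show ?thesis
      using coverable_mono[OF Gh le] by (rule conjI[rotated])
  qed
  have tele: "(\<Sum>i<n. f i q) = d q p - d q y" for q
    using sum_lessThan_telescope'[of "\<lambda>i. d q (x i)" n] x by (simp add: f_def)
  have pt: "N\<^sup>2 / 4 * ?B q \<le> N * (\<Sum>i<n. ?B q * (f i q)\<^sup>2)" if q: "q \<in> M" for q
  proof (cases "q \<in> mcball p (N / 4)")
    case True
    then have "d q p \<le> N / 4"
      by (simp add: commute)
    moreover have "N \<le> d q p + d q y"
      using triangle[of p q y] p q y by (simp add: N_def commute)
    ultimately have "N / 2 \<le> \<bar>\<Sum>i<n. f i q\<bar>"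
      unfolding tele by linarith
    then have "(N / 2)\<^sup>2 \<le> (\<Sum>i<n. f i q)\<^sup>2"
      using N power_mono[of "N / 2" "\<bar>\<Sum>i<n. f i q\<bar>" 2] by simp
    also have "\<dots> \<le> (\<Sum>i<n. (1::real)\<^sup>2) * (\<Sum>i<n. (f i q)\<^sup>2)"
      using Cauchy_Schwarz_ineq_sum[of "\<lambda>_. 1::real" "\<lambda>i. f i q" "{..<n}"] by simp
    finally show ?thesis
      using True by (simp add: N_def power_divide)
  qed (simp add: sum_nonneg N_def)
  have "N\<^sup>2 / 4 * cover_cost \<epsilon> ?B = cover_cost \<epsilon> (\<lambda>q. N\<^sup>2 / 4 * ?B q)"
    using N \<epsilon> by (intro cover_cost_scale[symmetric] coverable_ball) auto
  also have "\<dots> \<le> cover_cost \<epsilon> (\<lambda>q. N * (\<Sum>i<n. ?B q * (f i q)\<^sup>2))"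
    using cover_cost_sum_le[of "{..<n}" \<epsilon> "\<lambda>i q. ?B q * (f i q)\<^sup>2"] step n N pt
    by (intro cover_cost_mono coverable_scale) auto
  also have "\<dots> \<le> N * cover_cost \<epsilon> (\<lambda>q. \<Sum>i<n. ?B q * (f i q)\<^sup>2)"
    using cover_cost_sum_le[of "{..<n}" \<epsilon> "\<lambda>i q. ?B q * (f i q)\<^sup>2"] step n N
    by (intro cover_cost_scale_le) auto
  also have "\<dots> \<le> N * (\<Sum>i<n. cover_cost \<epsilon> (\<lambda>q. ?B q * (f i q)\<^sup>2))"
    using cover_cost_sum_le[of "{..<n}" \<epsilon> "\<lambda>i q. ?B q * (f i q)\<^sup>2"] step n N
    by (intro mult_left_mono) auto
  also have "\<dots> \<le> N * (\<Sum>i<n. cover_cost \<epsilon> ?G)"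
    using step N by (intro mult_left_mono sum_mono) auto
  also have "\<dots> = N\<^sup>2 * cover_cost \<epsilon> ?G"
    by (simp add: N_def power2_eq_square)
  finally show ?thesis
    using N by (simp add: N_def[symmetric])
qed

text \<open>
The domain consists of non-negative functions because covering numbers see only the positive part of a
function.
\<close>

definition invariant_mean :: "(('a \<Rightarrow> real) \<Rightarrow> real) \<Rightarrow> bool" where
  "invariant_mean \<Lambda> \<longleftrightarrow>
     (\<forall>f C. test_function f \<longrightarrow> (\<forall>q\<in>M. f q \<le> C) \<longrightarrow> 0 \<le> \<Lambda> f \<and> \<Lambda> f \<le> C) \<and>
     (\<forall>f g. test_function f \<longrightarrow> test_function g \<longrightarrow> (\<forall>q\<in>M. f q \<le> g q) \<longrightarrow> \<Lambda> f \<le> \<Lambda> g) \<and>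
     (\<forall>f g. test_function f \<longrightarrow> test_function g \<longrightarrow> \<Lambda> (\<lambda>q. f q + g q) = \<Lambda> f + \<Lambda> g) \<and>
     (\<forall>f a. test_function f \<longrightarrow> 0 < a \<longrightarrow> \<Lambda> (\<lambda>q. a * f q) = a * \<Lambda> f) \<and>
     (\<forall>f h. test_function f \<longrightarrow> similarity 1 h \<longrightarrow> \<Lambda> (\<lambda>q. f (h q)) = \<Lambda> f)"

text \<open>
The mean is a limit of normalized covering numbers in which the mesh \<open>1 / n\<close> tends to zero
(for additivity) while the radius \<open>n\<close> of the cutoff tends to infinity (for invariance). A mean that
vanished on all squared differences of distance functions would be useless, hence the second conclusion.
\<close>

proposition invariant_mean_exists:
  assumes p: "p \<in> M" and e: "e \<in> M" "d p e = 1"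
  obtains \<Lambda> where "invariant_mean \<Lambda>" "0 < \<Lambda> (\<lambda>q. (d q p - d q e)\<^sup>2)"
proof -
  define P where "P n f = cover_cost (1 / real (Suc n)) (\<lambda>q. cutoff p (real (Suc n)) q * f q)" for n f
  define T where "T n = cover_cost (1 / real (Suc n)) (cutoff p (real (Suc n)))" for n
  define A where "A n f = P n f / T n" for n f
  have N: "0 < real (Suc n)" "0 < 1 / real (Suc n)" for n
    by auto
  have T: "1 \<le> T n" "0 < T n" for n
    using cutoff_cost_ge_1[OF p N] by (auto simp: T_def intro: less_le_trans[OF zero_less_one])
  have cov: "coverable (1 / real (Suc n)) (\<lambda>q. cutoff p (real (Suc n)) q * f q)" if "test_function f" for n f
    by (rule test_function_coverable[OF p N that])
  have nn: "0 \<le> A n f" if "test_function f" for n f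
    using cover_cost_nonneg[OF cov[OF that]] T[of n] by (simp add: A_def P_def)
  have cutnn: "0 \<le> cutoff p (real (Suc n)) q" for n q
    by (simp add: cutoff_def)
  have mono: "A n f \<le> A n g" if "test_function g" "\<And>q. q \<in> M \<Longrightarrow> f q \<le> g q" for n f g
    unfolding A_def P_def using T[of n] that cutnn
    by (intro divide_right_mono cover_cost_mono cov mult_left_mono) auto
  have scale: "A n (\<lambda>q. a * f q) = a * A n f" if "test_function f" "0 < a" for n f a
    using cover_cost_scale[OF cov[OF that(1)] that(2), of n] by (simp add: A_def P_def mult.left_commute)
  have const_test: "test_function (\<lambda>q. C)" if "0 \<le> C" for C
    using that unfolding test_function_def by force
  have bound: "A n f \<le> C" if f: "test_function f" and C: "\<And>q. q \<in> M \<Longrightarrow> f q \<le> C" for n f C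
  proof (rule field_le_epsilon)
    fix \<eta> :: real assume "0 < \<eta>"
    have "0 \<le> f p"
      using f p by (auto simp: test_function_def)
    then have "0 < C + \<eta>"
      using C[OF p] \<open>0 < \<eta>\<close> by linarith
    have "A n f \<le> A n (\<lambda>q. (C + \<eta>) * 1)"
      using C \<open>0 < \<eta>\<close> \<open>0 < C + \<eta>\<close> const_test[of "C + \<eta>"] by (intro mono) (auto intro: add_increasing2)
    also have "\<dots> = (C + \<eta>) * A n (\<lambda>q. 1)"
      using \<open>0 < C + \<eta>\<close> const_test[of 1] by (intro scale) auto
    also have "A n (\<lambda>q. 1) = 1"
      using T[of n] by (simp add: A_def P_def T_def)
    finally show "A n f \<le> C + \<eta>"
      by simp
  qed
  have "\<exists>C. \<forall>n. \<bar>A n f\<bar> \<le> C" if f: "f \<in> Collect test_function" for f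
  proof -
    obtain C where "\<And>q. q \<in> M \<Longrightarrow> f q \<le> C"
      using f by (auto simp: test_function_def)
    then show ?thesis
      using bound[of f C] nn[of f] f by auto
  qed
  then obtain B where B: "\<And>n f. f \<in> Collect test_function \<Longrightarrow> \<bar>A n f\<bar> \<le> B f"
    by metis
  obtain G where G: "G \<noteq> bot" "G \<le> sequentially" and
    lim0: "\<And>f. f \<in> Collect test_function \<Longrightarrow> ((\<lambda>n. A n f) \<longlongrightarrow> Lim G (\<lambda>n. A n f)) G"
    using pointwise_limit_along_filter[of "Collect test_function" A B, OF B] by blast
  define \<Lambda> where "\<Lambda> f = Lim G (\<lambda>n. A n f)" for f
  have lim: "((\<lambda>n. A n f) \<longlongrightarrow> \<Lambda> f) G" if "test_function f" for f
    using lim0 that by (simp add: \<Lambda>_def)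
  have inv0: "((\<lambda>n. K / real (Suc n)) \<longlongrightarrow> 0) G" for K
    using LIMSEQ_Suc[OF lim_const_over_n[of K]] G(2) by (rule tendsto_mono[rotated])
  obtain m where m: "m > 0" "\<And>N \<epsilon>. 0 < N \<Longrightarrow> 0 < \<epsilon> \<Longrightarrow>
    cover_cost \<epsilon> (indicator (mcball p (4 * N))) \<le> m * cover_cost \<epsilon> (indicator (mcball p (N / 4)))"
    using cover_cost_doubling[OF p] by blast
  have big: "cover_cost (1 / real (Suc n)) (indicator (mcball p (4 * real (Suc n)))) \<le> m * T n" for n
  proof -
    have "cover_cost (1 / real (Suc n)) (indicator (mcball p (real (Suc n) / 4))) \<le> T n"
      unfolding T_def
    proof (rule cover_cost_mono[OF cutoff_coverable[OF p N]])
      fix q assume q: "q \<in> M"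
      have "indicator (mcball p (real (Suc n) / 4)) q \<le> (indicator (mcball p (2 * real (Suc n))) q :: real)"
        by (auto simp: indicator_def)
      also have "\<dots> \<le> cutoff p (real (Suc n)) q"
        by (rule cutoff_bounds(3)[OF p q N(1)])
      finally show "indicator (mcball p (real (Suc n) / 4)) q \<le> cutoff p (real (Suc n)) q" .
    qed
    then have "m * cover_cost (1 / real (Suc n)) (indicator (mcball p (real (Suc n) / 4))) \<le> m * T n"
      using m(1) by simp
    then show ?thesis
      using m(2)[OF N(1)[of n] N(2)[of n]] by linarith
  qed
  have "0 \<le> \<Lambda> f \<and> \<Lambda> f \<le> C" if f: "test_function f" and C: "\<forall>q\<in>M. f q \<le> C" for f C
    using tendsto_lowerbound[OF lim[OF f] _ G(1), of 0] tendsto_upperbound[OF lim[OF f] _ G(1), of C]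
      nn[OF f] bound[OF f, of C] C by simp
  moreover have "\<Lambda> f \<le> \<Lambda> g" if f: "test_function f" and g: "test_function g" and "\<forall>q\<in>M. f q \<le> g q" for f g
    using tendsto_le[OF G(1) lim[OF g] lim[OF f]] mono[OF g] that(3) by simp
  moreover have "\<Lambda> (\<lambda>q. a * f q) = a * \<Lambda> f" if f: "test_function f" and a: "0 < a" for f a
  proof -
    have "((\<lambda>n. A n (\<lambda>q. a * f q)) \<longlongrightarrow> a * \<Lambda> f) G"
      unfolding scale[OF f a] by (intro tendsto_intros lim f)
    then show ?thesis
      using tendsto_unique[OF G(1)] lim[OF test_function_scale[OF f, of a]] a by (meson less_imp_le)
  qed
  moreover have "\<Lambda> (\<lambda>q. f q + g q) = \<Lambda> f + \<Lambda> g" if f: "test_function f" and g: "test_function g" for f g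
  proof (rule antisym)
    have fg: "test_function (\<lambda>q. f q + g q)"
      by (rule test_function_add[OF f g])
    have "A n (\<lambda>q. f q + g q) \<le> A n f + A n g" for n
      using cover_cost_add_le[OF cov[OF f] cov[OF g], of n] T[of n]
      by (simp add: A_def P_def distrib_left divide_right_mono flip: add_divide_distrib)
    then show "\<Lambda> (\<lambda>q. f q + g q) \<le> \<Lambda> f + \<Lambda> g"
      using tendsto_le[OF G(1) tendsto_add[OF lim[OF f] lim[OF g]] lim[OF fg]] by simp
    obtain L1 where L1: "0 \<le> L1" "\<And>x y. x \<in> M \<Longrightarrow> y \<in> M \<Longrightarrow> \<bar>f x - f y\<bar> \<le> L1 * d x y"
      using f unfolding test_function_def by metis
    obtain L2 where L2: "0 \<le> L2" "\<And>x y. x \<in> M \<Longrightarrow> y \<in> M \<Longrightarrow> \<bar>g x - g y\<bar> \<le> L2 * d x y"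
      using g unfolding test_function_def by metis
    define L where "L = max L1 L2"
    have L: "0 \<le> L" "\<And>x y. x \<in> M \<Longrightarrow> y \<in> M \<Longrightarrow> \<bar>f x - f y\<bar> \<le> L * d x y"
        "\<And>x y. x \<in> M \<Longrightarrow> y \<in> M \<Longrightarrow> \<bar>g x - g y\<bar> \<le> L * d x y"
      using L1(1) order_trans[OF L1(2) mult_right_mono[of L1 L]] order_trans[OF L2(2) mult_right_mono[of L2 L]]
      by (auto simp: L_def)
    show "\<Lambda> f + \<Lambda> g \<le> \<Lambda> (\<lambda>q. f q + g q)"
    proof (rule field_le_epsilon)
      fix \<delta> :: real assume \<delta>: "0 < \<delta>"
      have "A n f + A n g \<le> (1 + (6 * L / \<delta>) / real (Suc n)) * (A n (\<lambda>q. f q + g q) + \<delta>)" for n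
      proof -
        have "P n f + P n g \<le> (1 + 6 * L * (1 / real (Suc n)) / \<delta>) * (P n (\<lambda>q. f q + g q) + \<delta> * T n)"
          unfolding P_def T_def
          using f g by (intro cover_cost_add_ge N(2) \<delta> L cutoff_coverable p N(1) cov fg cutnn) (auto simp: test_function_def)
        then have "(P n f + P n g) / T n \<le> (1 + 6 * L * (1 / real (Suc n)) / \<delta>) * (P n (\<lambda>q. f q + g q) + \<delta> * T n) / T n"
          using T[of n] by (intro divide_right_mono) auto
        also have "\<dots> = (1 + 6 * L * (1 / real (Suc n)) / \<delta>) * ((P n (\<lambda>q. f q + g q) + \<delta> * T n) / T n)"
          by (rule times_divide_eq_right[symmetric])
        also have "(P n (\<lambda>q. f q + g q) + \<delta> * T n) / T n = A n (\<lambda>q. f q + g q) + \<delta>"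
          using T[of n] by (simp add: A_def add_divide_distrib)
        also have "6 * L * (1 / real (Suc n)) / \<delta> = (6 * L / \<delta>) / real (Suc n)"
          by simp
        finally show ?thesis
          by (simp only: A_def add_divide_distrib)
      qed
      then show "\<Lambda> f + \<Lambda> g \<le> \<Lambda> (\<lambda>q. f q + g q) + \<delta>"
        using tendsto_le[OF G(1) tendsto_mult[OF tendsto_add[OF tendsto_const[of 1] inv0[of "6 * L / \<delta>"]]
            tendsto_add[OF lim[OF fg] tendsto_const[of \<delta>]]] tendsto_add[OF lim[OF f] lim[OF g]]] by simp
    qed
  qed
  moreover have "\<Lambda> (\<lambda>q. f (h q)) = \<Lambda> f" if f: "test_function f" and h: "similarity 1 h" for f h
  proof -
    have le: "\<Lambda> (\<lambda>q. g (k q)) \<le> \<Lambda> g" if g: "test_function g" and k: "similarity 1 k" for g k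
    proof -
      obtain C where C: "\<And>q. q \<in> M \<Longrightarrow> 0 \<le> g q \<and> g q \<le> C"
        using g unfolding test_function_def by metis
      then have "0 \<le> C"
        using p by force
      define D where "D = d p (k p)"
      have "A n (\<lambda>q. g (k q)) \<le> A n g + (D * C * m) / real (Suc n)" if n: "D \<le> real (Suc n)" for n
      proof -
        have "P n (\<lambda>q. g (k q)) \<le> P n g + D / real (Suc n) * C * cover_cost (1 / real (Suc n)) (indicator (mcball p (4 * real (Suc n))))"
          unfolding P_def D_def using C \<open>0 \<le> C\<close> n
          by (intro cover_cost_almost_invariant[OF p k N(1) _ N(2) g]) (auto simp: D_def)
        also have "\<dots> \<le> P n g + D / real (Suc n) * C * (m * T n)"
          using big \<open>0 \<le> C\<close> by (intro add_left_mono mult_left_mono) (auto simp: D_def)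
        finally have "P n (\<lambda>q. g (k q)) / T n \<le> (P n g + D / real (Suc n) * C * (m * T n)) / T n"
          using T[of n] by (intro divide_right_mono) auto
        then show ?thesis
          using T[of n] by (simp add: A_def add_divide_distrib mult.assoc)
      qed
      moreover have "eventually (\<lambda>n. D \<le> real (Suc n)) sequentially"
        using eventually_ge_at_top[of "nat \<lceil>D\<rceil>"] by eventually_elim linarith
      ultimately have "eventually (\<lambda>n. A n (\<lambda>q. g (k q)) \<le> A n g + (D * C * m) / real (Suc n)) G"
        using G(2) by (meson eventually_mono filter_leD)
      then show ?thesis
        using tendsto_le[OF G(1) tendsto_add[OF lim[OF g] inv0[of "D * C * m"]] lim[OF test_function_isometry[OF g k]]] by simp
    qed
    obtain k where k: "similarity 1 k" "\<And>x. x \<in> M \<Longrightarrow> h (k x) = x"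
      by (rule isometry_inverse[OF h]) blast
    have fh: "test_function (\<lambda>q. f (h q))"
      by (rule test_function_isometry[OF f h])
    have "A n f = A n (\<lambda>q. f (h (k q)))" for n
      unfolding A_def P_def using k(2) by (simp cong: cover_cost_cong)
    then have "\<Lambda> f = \<Lambda> (\<lambda>q. f (h (k q)))"
      by (simp add: \<Lambda>_def)
    also have "\<dots> \<le> \<Lambda> (\<lambda>q. f (h q))"
      by (rule le[OF fh k(1)])
    finally show ?thesis
      using le[OF f h] by simp
  qed
  moreover have "0 < \<Lambda> (\<lambda>q. (d q p - d q e)\<^sup>2)"
  proof -
    have test: "test_function (\<lambda>q. (d q p - d q e)\<^sup>2)"
      by (rule test_function_dist_diff[OF p e(1)])
    have "1 / (4 * m) \<le> A n (\<lambda>q. (d q p - d q e)\<^sup>2)" for n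
    proof -
      have "T n \<le> cover_cost (1 / real (Suc n)) (indicator (mcball p (4 * real (Suc n))))"
        unfolding T_def
      proof (rule cover_cost_mono[OF coverable_ball[OF N(2)]])
        fix q assume q: "q \<in> M"
        have "cutoff p (real (Suc n)) q \<le> indicator (mcball p (3 * real (Suc n))) q"
          by (rule cutoff_bounds(2)[OF p q N(1)])
        also have "\<dots> \<le> indicator (mcball p (4 * real (Suc n))) q"
          by (auto simp: indicator_def)
        finally show "cutoff p (real (Suc n)) q \<le> indicator (mcball p (4 * real (Suc n))) q" .
      qed
      also have "\<dots> \<le> m * cover_cost (1 / real (Suc n)) (indicator (mcball p (real (Suc n) / 4)))"
        by (rule m(2)[OF N])
      also have "\<dots> \<le> m * (4 * P n (\<lambda>q. (d q p - d q e)\<^sup>2))"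
        unfolding P_def using m(1) cover_cost_lower_bound[OF p e zero_less_Suc N(2)] by (intro mult_left_mono) auto
      finally show ?thesis
        using m(1) T[of n] by (simp add: A_def field_simps)
    qed
    then have "1 / (4 * m) \<le> \<Lambda> (\<lambda>q. (d q p - d q e)\<^sup>2)"
      using tendsto_lowerbound[OF lim[OF test] _ G(1)] by simp
    moreover have "0 < 1 / (4 * m)"
      using m(1) by simp
    ultimately show ?thesis
      by linarith
  qed
  ultimately show thesis
    using that[of \<Lambda>] unfolding invariant_mean_def by blast
qed

end

section \<open>Negative type and the inner product\<close>

text \<open>
This is the reason why the squared difference of the values of one function is a kernel of negative
type.
\<close>

lemma sum_square_differences:
  fixes c u :: "nat \<Rightarrow> real"
  assumes "(\<Sum>i<n. c i) = 0"
  shows "(\<Sum>i<n. \<Sum>j<n. c i * c j * (u i - u j)\<^sup>2) = - 2 * (\<Sum>i<n. c i * u i)\<^sup>2"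
proof -
  have "(\<Sum>i<n. \<Sum>j<n. c i * c j * (u i - u j)\<^sup>2) =
    (\<Sum>i<n. \<Sum>j<n. (c i * (u i)\<^sup>2) * c j + c i * (c j * (u j)\<^sup>2) - 2 * ((c i * u i) * (c j * u j)))"
    by (intro sum.cong refl) (simp add: power2_eq_square algebra_simps)
  also have "\<dots> = (\<Sum>i<n. c i * (u i)\<^sup>2) * (\<Sum>j<n. c j) + (\<Sum>i<n. c i) * (\<Sum>j<n. c j * (u j)\<^sup>2)
    - 2 * ((\<Sum>i<n. c i * u i) * (\<Sum>j<n. c j * u j))"
    by (simp add: sum.distrib sum_subtractf sum_product) (simp add: sum_distrib_left)
  finally show ?thesis
    using assms by (simp add: power2_eq_square)
qed

context Metric_space
begin

text \<open>
By Schoenberg's theorem this condition characterizes the subspaces of Hilbert spaces. Points are given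
as a finite sequence, in which repetitions are permitted; this avoids a case distinction when some of
the points coincide.
\<close>

definition negative_type :: bool where
  "negative_type \<longleftrightarrow> (\<forall>n (x :: nat \<Rightarrow> 'a) c. (\<forall>i<n. x i \<in> M) \<longrightarrow> (\<Sum>i<n. c i) = 0 \<longrightarrow>
     (\<Sum>i<n. \<Sum>j<n. c i * c j * (d (x i) (x j))\<^sup>2) \<le> 0)"

text \<open>
In a Hilbert space the vector \<open>v = m - (1 - t) x - t y\<close> has norm zero under the hypotheses on the
distances, so it is orthogonal to \<open>z - x\<close>, and this orthogonality is the claim. The proof applies
negative type to the coefficients of \<open>v + \<alpha> (z - x)\<close> for every \<open>\<alpha>\<close>.
\<close>

lemma stewart:
  assumes nt: negative_type and M: "x \<in> M" "y \<in> M" "m \<in> M" "z \<in> M"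
    and t: "d x m = t * d x y" "d m y = (1 - t) * d x y"
  shows "(d m z)\<^sup>2 = (1 - t) * (d x z)\<^sup>2 + t * (d y z)\<^sup>2 - t * (1 - t) * (d x y)\<^sup>2"
proof -
  define Q where "Q = (d x z)\<^sup>2"
  define S where "S = (d m z)\<^sup>2 - (1 - t) * (d x z)\<^sup>2 - t * (d y z)\<^sup>2 + t * (1 - t) * (d x y)\<^sup>2"
  have *: "\<alpha> * S \<le> \<alpha>\<^sup>2 * Q" for \<alpha>
  proof -
    let ?x = "\<lambda>i :: nat. [m, x, y, z] ! i" and ?c = "\<lambda>i :: nat. [1, - (1 - t) - \<alpha>, - t, \<alpha>] ! i"
    have "\<forall>i<4. ?x i \<in> M"
      using M by (auto simp: numeral_eq_Suc less_Suc_eq)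
    moreover have "(\<Sum>i<4. ?c i) = 0"
      by (simp add: numeral_eq_Suc lessThan_Suc)
    ultimately have le: "(\<Sum>i<4. \<Sum>j<4. ?c i * ?c j * (d (?x i) (?x j))\<^sup>2) \<le> 0"
      using nt unfolding negative_type_def by blast
    have "(\<Sum>i<4. \<Sum>j<4. ?c i * ?c j * (d (?x i) (?x j))\<^sup>2) =
      2 * ((- (1 - t) - \<alpha>) * (d x m)\<^sup>2 - t * (d m y)\<^sup>2 + \<alpha> * (d m z)\<^sup>2 + (- (1 - t) - \<alpha>) * (- t) * (d x y)\<^sup>2
       + (- (1 - t) - \<alpha>) * \<alpha> * (d x z)\<^sup>2 + (- t) * \<alpha> * (d y z)\<^sup>2)"
      using M by (simp add: eval_nat_numeral lessThan_Suc commute[of m x] commute[of y m] commute[of z m]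
          commute[of y x] commute[of z x] commute[of z y] algebra_simps)
    also have "\<dots> = 2 * (\<alpha> * S - \<alpha>\<^sup>2 * Q)"
      unfolding t S_def Q_def by (simp add: power2_eq_square algebra_simps)
    finally have "2 * (\<alpha> * S - \<alpha>\<^sup>2 * Q) \<le> 0"
      using le by metis
    then show ?thesis
      by simp
  qed
  \<comment> \<open>A linear function bounded by a quadratic one that vanishes to second order must be zero.\<close>
  define \<alpha> where "\<alpha> = S / (Q + 1)"
  have "0 \<le> Q"
    by (simp add: Q_def)
  then have S: "S = \<alpha> * (Q + 1)"
    by (simp add: \<alpha>_def)
  have "\<alpha>\<^sup>2 \<le> 0"
    using *[of \<alpha>] unfolding S by (simp add: power2_eq_square algebra_simps)
  then have "S = 0"
    by (simp add: S)
  then show ?thesis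
    by (simp add: S_def)
qed

text \<open>
This is the inner product of \<open>x - p\<close> and \<open>y - p\<close>, expressed by distances.
\<close>

definition gram :: "'a \<Rightarrow> 'a \<Rightarrow> 'a \<Rightarrow> real" where
  "gram p x y = ((d p x)\<^sup>2 + (d p y)\<^sup>2 - (d x y)\<^sup>2) / 2"

lemma gram_commute: "gram p x y = gram p y x"
  by (simp add: gram_def commute)

lemma gram_self: "x \<in> M \<Longrightarrow> gram p x x = (d p x)\<^sup>2"
  by (simp add: gram_def)

lemma gram_base: "p \<in> M \<Longrightarrow> gram p p x = 0"
  by (simp add: gram_def)

lemma dist_gram: "x \<in> M \<Longrightarrow> y \<in> M \<Longrightarrow> (d x y)\<^sup>2 = gram p x x - 2 * gram p x y + gram p y y"
  by (simp add: gram_def field_simps)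

lemma gram_between:
  assumes nt: negative_type and M: "p \<in> M" "x \<in> M" "y \<in> M" "m \<in> M" "z \<in> M"
    and t: "d x m = t * d x y" "d m y = (1 - t) * d x y"
  shows "gram p m z = (1 - t) * gram p x z + t * gram p y z"
  using stewart[OF nt M(2,3,4,5) t] stewart[OF nt M(2,3,4,1) t]
  by (simp add: gram_def commute[of _ p] field_simps)

end

context homogeneous_geodesic_space
begin

context
  fixes \<Lambda>
  assumes \<Lambda>: "invariant_mean \<Lambda>"
begin

lemma mean_bounds: "test_function f \<Longrightarrow> (\<And>q. q \<in> M \<Longrightarrow> f q \<le> C) \<Longrightarrow> 0 \<le> \<Lambda> f \<and> \<Lambda> f \<le> C"
  using \<Lambda> unfolding invariant_mean_def by blast

lemma mean_mono: "test_function f \<Longrightarrow> test_function g \<Longrightarrow> (\<And>q. q \<in> M \<Longrightarrow> f q \<le> g q) \<Longrightarrow> \<Lambda> f \<le> \<Lambda> g"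
  using \<Lambda> unfolding invariant_mean_def by blast

lemma mean_add: "test_function f \<Longrightarrow> test_function g \<Longrightarrow> \<Lambda> (\<lambda>q. f q + g q) = \<Lambda> f + \<Lambda> g"
  using \<Lambda> unfolding invariant_mean_def by blast

lemma mean_isometry: "test_function f \<Longrightarrow> similarity 1 h \<Longrightarrow> \<Lambda> (\<lambda>q. f (h q)) = \<Lambda> f"
  using \<Lambda> unfolding invariant_mean_def by blast

lemma mean_scale:
  assumes "test_function f" "0 \<le> a"
  shows "\<Lambda> (\<lambda>q. a * f q) = a * \<Lambda> f"
proof (cases "a = 0")
  case True
  then show ?thesis
    using mean_bounds[OF test_function_scale[OF assms], of 0] by simp
next
  case False
  then show ?thesis
    using assms \<Lambda> unfolding invariant_mean_def by simp
qed

lemma mean_sum: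
  assumes "finite I" "\<And>i. i \<in> I \<Longrightarrow> test_function (f i)" "\<And>i. i \<in> I \<Longrightarrow> 0 \<le> (a i :: real)"
  shows "test_function (\<lambda>q. \<Sum>i\<in>I. a i * f i q) \<and> \<Lambda> (\<lambda>q. \<Sum>i\<in>I. a i * f i q) = (\<Sum>i\<in>I. a i * \<Lambda> (f i))"
  using assms
proof (induction rule: finite_induct)
  case empty
  have zero: "test_function (\<lambda>q. 0)"
    by (force simp: test_function_def)
  then show ?case
    using mean_bounds[OF zero, of 0] by simp
next
  case (insert i I)
  have i: "test_function (\<lambda>q. a i * f i q)" "\<Lambda> (\<lambda>q. a i * f i q) = a i * \<Lambda> (f i)"
    using insert.prems by (auto intro: test_function_scale mean_scale)
  have I: "test_function (\<lambda>q. \<Sum>i\<in>I. a i * f i q)" "\<Lambda> (\<lambda>q. \<Sum>i\<in>I. a i * f i q) = (\<Sum>i\<in>I. a i * \<Lambda> (f i))"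
    using insert by auto
  show ?case
    using test_function_add[OF i(1) I(1)] mean_add[OF i(1) I(1)] i(2) I(2) insert.hyps by simp
qed

definition mean_sqdiff :: "'a \<Rightarrow> 'a \<Rightarrow> real" where
  "mean_sqdiff a b = \<Lambda> (\<lambda>q. (d q a - d q b)\<^sup>2)"

lemma mean_sqdiff_bounds:
  assumes "a \<in> M" "b \<in> M"
  shows "0 \<le> mean_sqdiff a b" "mean_sqdiff a b \<le> (d a b)\<^sup>2"
proof -
  have "(d q a - d q b)\<^sup>2 \<le> (d a b)\<^sup>2" if "q \<in> M" for q
    using power_mono[of "\<bar>d q a - d q b\<bar>" "d a b" 2] mdist_reverse_triangle[of a q b] assms that
    by (simp add: commute)
  then show "0 \<le> mean_sqdiff a b" "mean_sqdiff a b \<le> (d a b)\<^sup>2"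
    using mean_bounds[OF test_function_dist_diff[OF assms], of "(d a b)\<^sup>2"] by (auto simp: mean_sqdiff_def)
qed

lemma mean_sqdiff_cong:
  assumes "a \<in> M" "b \<in> M" "a' \<in> M" "b' \<in> M" "d a b = d a' b'"
  shows "mean_sqdiff a b = mean_sqdiff a' b'"
proof (cases "a = b")
  case True
  then have "a' = b'"
    using assms by simp
  with True show ?thesis
    by (simp add: mean_sqdiff_def)
next
  case False
  then obtain h where h: "similarity 1 h" "h a = a'" "h b = b'"
    using isometry_on_pairs assms by blast
  note hD = similarityD[OF h(1)]
  have test: "test_function (\<lambda>q. (d q a - d q b)\<^sup>2)" "test_function (\<lambda>q. (d q a' - d q b')\<^sup>2)"
    by (intro test_function_dist_diff assms)+
  have eq: "(d q a - d q b)\<^sup>2 = (d (h q) a' - d (h q) b')\<^sup>2" if "q \<in> M" for q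
    using hD(4)[OF that assms(1)] hD(4)[OF that assms(2)] h by simp
  have "mean_sqdiff a b = \<Lambda> (\<lambda>q. (d (h q) a' - d (h q) b')\<^sup>2)"
    unfolding mean_sqdiff_def
    by (intro antisym mean_mono test(1) test_function_isometry[OF test(2) h(1)]) (simp_all add: eq)
  also have "\<dots> = mean_sqdiff a' b'"
    unfolding mean_sqdiff_def by (rule mean_isometry[OF test(2) h(1)])
  finally show ?thesis .
qed

text \<open>
The mean is defined on non-negative functions, so the coefficients are separated into their positive
and negative parts before the pointwise inequality is averaged.
\<close>

lemma mean_sqdiff_negative_type:
  fixes x :: "nat \<Rightarrow> 'a" and c :: "nat \<Rightarrow> real"
  assumes x: "\<And>i. i < n \<Longrightarrow> x i \<in> M" and c: "(\<Sum>i<n. c i) = 0"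
  shows "(\<Sum>i<n. \<Sum>j<n. c i * c j * mean_sqdiff (x i) (x j)) \<le> 0"
proof -
  let ?I = "{..<n} \<times> {..<n}"
  define f where "f = (\<lambda>(i, j) q. (d q (x i) - d q (x j))\<^sup>2)"
  \<comment> \<open>These are the positive and the negative part of \<open>c i * c j\<close>.\<close>
  define a b where "a = (\<lambda>(i, j). max 0 (c i * c j))" and "b = (\<lambda>(i, j). max 0 (- (c i * c j)))"
  have test: "test_function (f ij)" if "ij \<in> ?I" for ij
    using that x by (auto simp: f_def intro: test_function_dist_diff)
  have ab: "0 \<le> a ij" "0 \<le> b ij" if "ij \<in> ?I" for ij
    by (auto simp: a_def b_def split: prod.split)
  have diff: "a ij - b ij = (case ij of (i, j) \<Rightarrow> c i * c j)" for ij
    by (auto simp: a_def b_def split: prod.split)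
  note A = mean_sum[of ?I f a, OF _ test ab(1)]
  note B = mean_sum[of ?I f b, OF _ test ab(2)]
  have "(\<Sum>ij\<in>?I. a ij * f ij q) \<le> (\<Sum>ij\<in>?I. b ij * f ij q)" for q
  proof -
    have "(\<Sum>ij\<in>?I. a ij * f ij q) - (\<Sum>ij\<in>?I. b ij * f ij q) = (\<Sum>ij\<in>?I. (a ij - b ij) * f ij q)"
      by (simp add: sum_subtractf left_diff_distrib)
    also have "\<dots> = (\<Sum>i<n. \<Sum>j<n. c i * c j * (d q (x i) - d q (x j))\<^sup>2)"
      unfolding diff by (simp add: f_def sum.cartesian_product case_prod_unfold)
    also have "\<dots> \<le> 0"
      by (simp add: sum_square_differences[OF c])
    finally show ?thesis
      by simp
  qed
  then have "(\<Sum>ij\<in>?I. a ij * \<Lambda> (f ij)) \<le> (\<Sum>ij\<in>?I. b ij * \<Lambda> (f ij))"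
    using mean_mono[of "\<lambda>q. \<Sum>ij\<in>?I. a ij * f ij q" "\<lambda>q. \<Sum>ij\<in>?I. b ij * f ij q"] A B by simp
  moreover have "(\<Sum>i<n. \<Sum>j<n. c i * c j * mean_sqdiff (x i) (x j)) = (\<Sum>ij\<in>?I. (a ij - b ij) * \<Lambda> (f ij))"
    unfolding diff by (simp add: f_def mean_sqdiff_def sum.cartesian_product case_prod_unfold)
  ultimately show ?thesis
    by (simp add: sum_subtractf left_diff_distrib)
qed

lemma mean_sqdiff_triangle:
  assumes M: "a \<in> M" "b \<in> M" "m \<in> M"
  shows "sqrt (mean_sqdiff a b) \<le> sqrt (mean_sqdiff a m) + sqrt (mean_sqdiff m b)"
proof (rule sqrt_le_add_sqrt)
  fix t :: real assume t: "0 < t"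
  let ?f = "\<lambda>a b q. (d q a - d q b)\<^sup>2"
  have test: "test_function (?f a b)" "test_function (?f a m)" "test_function (?f m b)"
    by (intro test_function_dist_diff M)+
  have scaled: "test_function (\<lambda>q. (1 + t) * ?f a m q)" "test_function (\<lambda>q. (1 + 1 / t) * ?f m b q)"
    using test t by (auto intro!: test_function_scale)
  have "(u + v)\<^sup>2 \<le> (1 + t) * u\<^sup>2 + (1 + 1 / t) * v\<^sup>2" for u v :: real
  proof -
    have "(1 + t) * u\<^sup>2 + (1 + 1 / t) * v\<^sup>2 - (u + v)\<^sup>2 = (t * u - v)\<^sup>2 / t"
      using t by (simp add: power2_eq_square field_simps)
    also have "\<dots> \<ge> 0"
      using t by simp
    finally show ?thesis
      by simp
  qed
  from this[of "d q a - d q m" "d q m - d q b" for q]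
  have "mean_sqdiff a b \<le> \<Lambda> (\<lambda>q. (1 + t) * ?f a m q + (1 + 1 / t) * ?f m b q)"
    unfolding mean_sqdiff_def by (intro mean_mono test test_function_add scaled) simp
  also have "\<dots> = (1 + t) * mean_sqdiff a m + (1 + 1 / t) * mean_sqdiff m b"
    unfolding mean_add[OF scaled] mean_sqdiff_def using test t by (simp add: mean_scale)
  finally show "mean_sqdiff a b \<le> (1 + t) * mean_sqdiff a m + (1 + 1 / t) * mean_sqdiff m b" .
qed (use mean_sqdiff_bounds M in auto)

end

text \<open>
The averaged kernel is \<open>(\<phi> (d a b))\<^sup>2\<close>, because isometries act transitively on pairs at equal
distance. Evaluated at the images of the given points under a dilation of ratio \<open>l\<close> and divided by
\<open>l\<^sup>2\<close>, it is still of negative type, and for \<open>l \<rightarrow> 0\<close> it converges to a positive multiple of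
the squared distance.
\<close>

theorem negative_type: negative_type
proof -
  obtain p where p: "p \<in> M"
    using two_points by blast
  define pt where "pt r = (SOME q. q \<in> M \<and> d p q = r)" for r
  have pt: "pt r \<in> M" "d p (pt r) = r" if "0 \<le> r" for r
    using someI_ex[of "\<lambda>q. q \<in> M \<and> d p q = r"] sphere_nonempty[OF p that] by (auto simp: pt_def)
  obtain \<Lambda> where \<Lambda>: "invariant_mean \<Lambda>" and pos: "0 < \<Lambda> (\<lambda>q. (d q p - d q (pt 1))\<^sup>2)"
    using invariant_mean_exists[OF p, of "pt 1"] pt[of 1] by auto
  define \<phi> where "\<phi> r = sqrt (mean_sqdiff \<Lambda> p (pt r))" for r
  have \<phi>: "sqrt (mean_sqdiff \<Lambda> a b) = \<phi> (d a b)" if "a \<in> M" "b \<in> M" for a b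
    using mean_sqdiff_cong[OF \<Lambda> that p, of "pt (d a b)"] pt by (simp add: \<phi>_def)
  have \<phi>2: "mean_sqdiff \<Lambda> a b = (\<phi> (d a b))\<^sup>2" if "a \<in> M" "b \<in> M" for a b
    using \<phi>[OF that] mean_sqdiff_bounds(1)[OF \<Lambda> that] by (metis real_sqrt_pow2)
  obtain c0 where c0: "0 < c0" "((\<lambda>r. \<phi> r / r) \<longlongrightarrow> c0) (at_right 0)"
  proof (rule subadditive_slope_at_0[of \<phi>])
    show "\<phi> (a + b) \<le> \<phi> a + \<phi> b" if ab: "0 \<le> a" "0 \<le> b" for a b
    proof -
      let ?y = "pt (a + b)"
      have y: "?y \<in> M" "d p ?y = a + b"
        using pt ab by auto
      have "0 \<le> a / (a + b)" "a / (a + b) \<le> 1"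
        using ab by (auto simp: divide_le_eq_1)
      then obtain m where m': "m \<in> M" "d p m = a / (a + b) * d p ?y" "d m ?y = (1 - a / (a + b)) * d p ?y"
        using between[OF p y(1)] by blast
      have "a / (a + b) * (a + b) = a" "(1 - a / (a + b)) * (a + b) = b"
        using ab by (auto simp: left_diff_distrib)
      then have m: "m \<in> M" "d p m = a" "d m ?y = b"
        using m' y(2) by auto
      show ?thesis
        using mean_sqdiff_triangle[OF \<Lambda> p y(1) m(1)] \<phi>[OF p y(1)] \<phi>[OF p m(1)] \<phi>[OF m(1) y(1)] y m by simp
    qed
    show "\<phi> r \<le> r" if "0 \<le> r" for r
      using mean_sqdiff_bounds(2)[OF \<Lambda> p pt(1)[OF that]] that pt(2)[OF that]
      unfolding \<phi>_def by (simp add: real_le_lsqrt)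
    show "0 < \<phi> 1"
      using pos by (simp add: \<phi>_def mean_sqdiff_def[OF \<Lambda>])
  qed blast
  have \<phi>0: "\<phi> 0 = 0"
    using \<phi>[OF p p] mean_sqdiff_bounds[OF \<Lambda> p p] p by simp
  have lim: "((\<lambda>l. (\<phi> (l * D) / l)\<^sup>2) \<longlongrightarrow> (c0 * D)\<^sup>2) (at_right 0)" if D: "0 \<le> D" for D
  proof (cases "D = 0")
    case False
    with D have D: "0 < D"
      by simp
    have "((\<lambda>l. l * D) \<longlongrightarrow> 0 * D) (at_right 0)"
      by (intro tendsto_intros)
    moreover have "eventually (\<lambda>l. 0 < l * D) (at_right 0)"
      using D by (intro eventually_mono[OF eventually_at_right_less[of 0]]) simp
    ultimately have "filterlim (\<lambda>l. l * D) (at_right 0) (at_right 0)"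
      by (auto simp: filterlim_at elim: eventually_mono)
    then have "((\<lambda>l. \<phi> (l * D) / (l * D)) \<longlongrightarrow> c0) (at_right 0)"
      by (rule filterlim_compose[OF c0(2)])
    then have "((\<lambda>l. (\<phi> (l * D) / (l * D) * D)\<^sup>2) \<longlongrightarrow> (c0 * D)\<^sup>2) (at_right 0)"
      by (intro tendsto_intros)
    then show ?thesis
      using D by simp
  qed (simp add: \<phi>0)
  show ?thesis
    unfolding negative_type_def
  proof (intro allI impI)
    fix n and x :: "nat \<Rightarrow> 'a" and c :: "nat \<Rightarrow> real"
    assume x: "\<forall>i<n. x i \<in> M" and c: "(\<Sum>i<n. c i) = 0"
    have "(\<Sum>i<n. \<Sum>j<n. c i * c j * (\<phi> (l * d (x i) (x j)) / l)\<^sup>2) \<le> 0" if l: "0 < l" for l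
    proof -
      obtain u where u: "similarity l u"
        using dilation_about_point p l by blast
      note uD = similarityD[OF u]
      have "(\<Sum>i<n. \<Sum>j<n. c i * c j * mean_sqdiff \<Lambda> (u (x i)) (u (x j))) \<le> 0"
        using x uD(3) by (intro mean_sqdiff_negative_type[OF \<Lambda> _ c]) auto
      moreover have "mean_sqdiff \<Lambda> (u (x i)) (u (x j)) = (\<phi> (l * d (x i) (x j)))\<^sup>2" if "i < n" "j < n" for i j
        using \<phi>2[of "u (x i)" "u (x j)"] uD(3,4) x that by simp
      ultimately have "(\<Sum>i<n. \<Sum>j<n. c i * c j * (\<phi> (l * d (x i) (x j)))\<^sup>2) / l\<^sup>2 \<le> 0"
        by (intro divide_nonpos_nonneg) auto
      then show ?thesis
        by (simp add: sum_divide_distrib power_divide)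
    qed
    then have ev: "eventually (\<lambda>l. (\<Sum>i<n. \<Sum>j<n. c i * c j * (\<phi> (l * d (x i) (x j)) / l)\<^sup>2) \<le> 0) (at_right 0)"
      by (intro eventually_mono[OF eventually_at_right_less[of 0]])
    have "((\<lambda>l. \<Sum>i<n. \<Sum>j<n. c i * c j * (\<phi> (l * d (x i) (x j)) / l)\<^sup>2) \<longlongrightarrow>
      (\<Sum>i<n. \<Sum>j<n. c i * c j * (c0 * d (x i) (x j))\<^sup>2)) (at_right 0)"
      by (intro tendsto_intros lim) auto
    then have "(\<Sum>i<n. \<Sum>j<n. c i * c j * (c0 * d (x i) (x j))\<^sup>2) \<le> 0"
      using tendsto_upperbound[OF _ ev trivial_limit_at_right_real] by blast
    also have "(\<Sum>i<n. \<Sum>j<n. c i * c j * (c0 * d (x i) (x j))\<^sup>2) =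
      c0\<^sup>2 * (\<Sum>i<n. \<Sum>j<n. c i * c j * (d (x i) (x j))\<^sup>2)"
      by (simp add: sum_distrib_left power_mult_distrib mult_ac)
    finally show "(\<Sum>i<n. \<Sum>j<n. c i * c j * (d (x i) (x j))\<^sup>2) \<le> 0"
      using c0(1) by (simp add: mult_le_0_iff)
  qed
qed

context
  fixes p
  assumes p: "p \<in> M"
begin

text \<open>
Multiples of \<open>x\<close> by factors in \<open>[0, 1]\<close> lie between \<open>p\<close> and \<open>x\<close>; larger factors are reached
by extending the geodesic beyond \<open>x\<close>, and negative ones by extending it beyond \<open>p\<close>.
\<close>

lemma gram_scale_exists:
  assumes x: "x \<in> M"
  shows "\<exists>y\<in>M. \<forall>z\<in>M. gram p y z = a * gram p x z"
proof (cases "x = p")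
  case True
  then show ?thesis
    using p by (intro bexI[of _ p]) (auto simp: gram_base)
next
  case False
  consider "0 \<le> a" "a \<le> 1" | "1 < a" | "a < 0"
    by linarith
  then show ?thesis
  proof cases
    case 1
    then obtain y where y: "y \<in> M" "d p y = a * d p x" "d y x = (1 - a) * d p x"
      using between[OF p x] by blast
    then show ?thesis
      using gram_between[OF negative_type p p x y(1) _ y(2,3)] p by (auto simp: gram_base)
  next
    case 2
    then obtain y where y: "y \<in> M" "d p x = 1 / a * d p y" "d x y = (1 - 1 / a) * d p y"
      using collinear_extension[OF p x, of "1 / a"] False by auto
    then show ?thesis
      using gram_between[OF negative_type p p y(1) x _ y(2,3)] p 2 by (auto simp: gram_base)
  next
    case 3
    \<comment> \<open>The proportion \<open>1 / (1 - a)\<close> is chosen so that \<open>p\<close>, as the origin, is the combination of \<open>x\<close> and \<open>a * x\<close>.\<close>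
    then obtain y where y: "y \<in> M" "d x p = 1 / (1 - a) * d x y" "d p y = (1 - 1 / (1 - a)) * d x y"
      using collinear_extension[OF x p, of "1 / (1 - a)"] False by auto
    have "gram p y z = a * gram p x z" if z: "z \<in> M" for z
    proof -
      have "0 = (1 - 1 / (1 - a)) * gram p x z + 1 / (1 - a) * gram p y z"
        using gram_between[OF negative_type p x y(1) p z y(2,3)] p by (simp add: gram_base)
      then have "0 = (1 - a) * ((1 - 1 / (1 - a)) * gram p x z + 1 / (1 - a) * gram p y z)"
        by simp
      also have "\<dots> = (1 - a) * gram p x z - ((1 - a) * (1 / (1 - a))) * gram p x z
          + ((1 - a) * (1 / (1 - a))) * gram p y z"
        by (simp only: algebra_simps)
      also have "(1 - a) * (1 / (1 - a)) = 1"
        using 3 by simp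
      finally show ?thesis
        by (simp add: algebra_simps)
    qed
    with y(1) show ?thesis
      by blast
  qed
qed

text \<open>
The sum is twice the midpoint.
\<close>

lemma gram_add_exists:
  assumes x: "x \<in> M" and y: "y \<in> M"
  shows "\<exists>w\<in>M. \<forall>z\<in>M. gram p w z = gram p x z + gram p y z"
proof -
  obtain m where m: "m \<in> M" "d x m = 1 / 2 * d x y" "d m y = (1 - 1 / 2) * d x y"
    using between[OF x y, of "1 / 2"] by auto
  obtain w where w: "w \<in> M" "\<forall>z\<in>M. gram p w z = 2 * gram p m z"
    using gram_scale_exists[OF m(1)] by blast
  show ?thesis
    using gram_between[OF negative_type p x y m(1) _ m(2,3)] w by (intro bexI[of _ w]) (auto simp: field_simps)
qed

lemma gram_combination_exists:
  fixes k :: nat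
  assumes "\<And>i. i < k \<Longrightarrow> e i \<in> M"
  shows "\<exists>w\<in>M. \<forall>z\<in>M. gram p w z = (\<Sum>i<k. a i * gram p (e i) z)"
  using assms
proof (induction k)
  case 0
  then show ?case
    using p by (intro bexI[of _ p]) (auto simp: gram_base)
next
  case (Suc k)
  then obtain w where w: "w \<in> M" "\<forall>z\<in>M. gram p w z = (\<Sum>i<k. a i * gram p (e i) z)"
    by auto
  obtain v where v: "v \<in> M" "\<forall>z\<in>M. gram p v z = a k * gram p (e k) z"
    using gram_scale_exists[of "e k"] Suc.prems by blast
  show ?case
    using gram_add_exists[OF w(1) v(1)] w(2) v(2) by simp
qed

definition orthonormal :: "nat \<Rightarrow> (nat \<Rightarrow> 'a) \<Rightarrow> bool" where
  "orthonormal k e \<longleftrightarrow> (\<forall>i<k. e i \<in> M) \<and> (\<forall>i<k. \<forall>j<k. gram p (e i) (e j) = (if i = j then 1 else 0))"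

text \<open>
Orthonormal points have mutual distance \<open>sqrt 2\<close>, so that each ball in a cover of the unit ball by
balls of radius \<open>1 / 2\<close> contains at most one of them.
\<close>

lemma orthonormal_bounded: "\<exists>m. \<forall>k e. orthonormal k e \<longrightarrow> k \<le> m"
proof -
  obtain K where K: "finite K" "K \<subseteq> mcball p 1" "mcball p 1 \<subseteq> (\<Union>x\<in>K. mball x (1 / 2))"
    using balls_totally_bounded[of p 1, unfolded mtotally_bounded_def, rule_format, of "1 / 2"] by auto
  have "k \<le> card K" if e: "orthonormal k e" for k e
  proof -
    have eM: "e i \<in> M" "gram p (e i) (e i) = 1" if "i < k" for i
      using e that by (auto simp: orthonormal_def)
    have "\<exists>c. c \<in> K \<and> e i \<in> mball c (1 / 2)" if "i < k" for i
    proof -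
      have "(d p (e i))\<^sup>2 = 1"
        using eM[OF that] gram_self[of "e i" p] by simp
      then have "d p (e i) = 1"
        using nonneg[of p "e i"] by (simp add: power2_eq_1_iff)
      then have "e i \<in> mcball p 1"
        using eM[OF that] p by simp
      then show ?thesis
        using K(3) by blast
    qed
    then obtain c where c: "\<And>i. i < k \<Longrightarrow> c i \<in> K \<and> e i \<in> mball (c i) (1 / 2)"
      by metis
    have "inj_on c {..<k}"
    proof (rule inj_onI, rule ccontr)
      fix i j assume ij: "i \<in> {..<k}" "j \<in> {..<k}" "c i = c j" "i \<noteq> j"
      have "d (e i) (e j) \<le> d (e i) (c i) + d (c i) (e j)"
        using c[of i] c[of j] ij by (intro triangle) auto
      also have "\<dots> < 1"
        using c[of i] c[of j] ij by (simp add: commute[of "e i"])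
      finally have "(d (e i) (e j))\<^sup>2 < 1"
        by (simp add: power_less_one_iff abs_square_less_1)
      moreover have "(d (e i) (e j))\<^sup>2 = 2"
        using dist_gram[of "e i" "e j" p] eM ij e by (simp add: orthonormal_def)
      ultimately show False
        by simp
    qed
    then show ?thesis
      using card_inj_on_le[of c "{..<k}" K] c K(1) by auto
  qed
  then show ?thesis
    by blast
qed

text \<open>
A maximal orthonormal family satisfies Parseval's identity: otherwise the residual of some point, rescaled
to unit length, would extend the family.
\<close>

lemma orthonormal_basis_exists:
  obtains k e where "orthonormal k e"
    "\<And>x z. x \<in> M \<Longrightarrow> z \<in> M \<Longrightarrow> gram p x z = (\<Sum>i<k. gram p x (e i) * gram p (e i) z)"
proof -
  obtain m where m: "\<And>k e. orthonormal k e \<Longrightarrow> k \<le> m"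
    using orthonormal_bounded by blast
  have "\<exists>k. (\<exists>e. orthonormal k e) \<and> \<not> (\<exists>e. orthonormal (Suc k) e)"
  proof (rule ccontr)
    assume *: "\<not> ?thesis"
    have "\<exists>e. orthonormal k e" for k
    proof (induction k)
      case 0
      show ?case
        by (simp add: orthonormal_def)
    qed (use * in blast)
    then show False
      using m Suc_n_not_le_n by blast
  qed
  then obtain k e where e: "orthonormal k e" and max: "\<And>e. \<not> orthonormal (Suc k) e"
    by blast
  have eM: "e i \<in> M" if "i < k" for i
    using e that by (simp add: orthonormal_def)
  have eo: "gram p (e i) (e j) = (if i = j then 1 else 0)" if "i < k" "j < k" for i j
    using e that by (simp add: orthonormal_def)
  have "gram p x z = (\<Sum>i<k. gram p x (e i) * gram p (e i) z)" if x: "x \<in> M" and z: "z \<in> M" for x z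
  proof -
    obtain s where s: "s \<in> M" "\<forall>z\<in>M. gram p s z = (\<Sum>i<k. (- gram p x (e i)) * gram p (e i) z)"
      using gram_combination_exists[where e = e and a = "\<lambda>i. - gram p x (e i)" and k = k, OF eM] by blast
    obtain y where y: "y \<in> M" "\<forall>z\<in>M. gram p y z = gram p x z + gram p s z"
      using gram_add_exists[OF x s(1)] by blast
    have y_eq: "gram p y z = gram p x z - (\<Sum>i<k. gram p x (e i) * gram p (e i) z)" if "z \<in> M" for z
      using y(2) s(2) that by (simp add: sum_negf)
    have perp: "gram p y (e j) = 0" if j: "j < k" for j
    proof -
      have "(\<Sum>i<k. gram p x (e i) * gram p (e i) (e j)) = (\<Sum>i<k. if i = j then gram p x (e i) else 0)"
        using j by (intro sum.cong) (auto simp: eo)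
      then show ?thesis
        using y_eq[OF eM[OF j]] j by simp
    qed
    have "y = p"
    proof (rule ccontr)
      assume "y \<noteq> p"
      then have D: "0 < d p y"
        using p y(1) by simp
      obtain v where v: "v \<in> M" "\<forall>z\<in>M. gram p v z = 1 / d p y * gram p y z"
        using gram_scale_exists[OF y(1)] by blast
      have "gram p v v = 1 / d p y * (1 / d p y * gram p y y)"
        using v y(1) gram_commute[of p y v] by simp
      then have vv: "gram p v v = 1"
        using D gram_self[OF y(1), of p] by (simp add: power2_eq_square)
      have ve: "gram p v (e j) = 0" "gram p (e j) v = 0" if "j < k" for j
        using v(2) perp[OF that] eM[OF that] gram_commute[of p v "e j"] by auto
      have "orthonormal (Suc k) (e(k := v))"
        unfolding orthonormal_def using v(1) vv ve eM eo by (auto simp: less_Suc_eq)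
      then show False
        using max by blast
    qed
    then show ?thesis
      using y_eq[OF z] p by (simp add: gram_base)
  qed
  with e show thesis
    using that by blast
qed

end

theorem isometric_euclidean: "\<exists>n>0. isometric M d (euclidean_carrier n) (euclidean_dist n)"
proof -
  obtain p where p: "p \<in> M"
    using two_points by blast
  obtain k e where e: "orthonormal p k e"
    and basis: "\<And>x z. x \<in> M \<Longrightarrow> z \<in> M \<Longrightarrow> gram p x z = (\<Sum>i<k. gram p x (e i) * gram p (e i) z)"
    using orthonormal_basis_exists[OF p] by blast
  have eM: "e i \<in> M" if "i < k" for i
    using e that by (simp add: orthonormal_def[OF p])
  have eo: "gram p (e i) (e j) = (if i = j then 1 else 0)" if "i < k" "j < k" for i j
    using e that by (simp add: orthonormal_def[OF p])
  define f where "f x i = (if i < k then gram p x (e i) else 0)" for x and i :: nat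
  have dist: "euclidean_dist k (f x) (f y) = d x y" if xy: "x \<in> M" "y \<in> M" for x y
  proof -
    have "(d x y)\<^sup>2 = (\<Sum>i<k. gram p x (e i) * gram p x (e i) - 2 * (gram p x (e i) * gram p y (e i)) + gram p y (e i) * gram p y (e i))"
      unfolding dist_gram[OF xy, of p] basis[OF xy(1) xy(1)] basis[OF xy] basis[OF xy(2) xy(2)]
      by (simp add: gram_commute[of p "e _"] sum.distrib sum_subtractf sum_distrib_left)
    also have "\<dots> = (\<Sum>i<k. (f x i - f y i)\<^sup>2)"
      by (intro sum.cong) (auto simp: f_def power2_eq_square algebra_simps)
    finally have eq: "(\<Sum>i<k. (f x i - f y i)\<^sup>2) = (d x y)\<^sup>2"
      by (rule sym)
    show ?thesis
      unfolding euclidean_dist_def eq by simp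
  qed
  have carrier: "f x \<in> euclidean_carrier k" for x
    by (simp add: f_def euclidean_carrier_def topspace_Euclidean_space)
  have "bij_betw f M (euclidean_carrier k)"
    unfolding bij_betw_def
  proof
    show "inj_on f M"
    proof (rule inj_onI)
      fix x y assume "x \<in> M" "y \<in> M" "f x = f y"
      then have "d x y = 0"
        using dist[of x y] by (simp add: euclidean_dist_def)
      then show "x = y"
        using \<open>x \<in> M\<close> \<open>y \<in> M\<close> by simp
    qed
    have "v \<in> f ` M" if v: "v \<in> euclidean_carrier k" for v
    proof -
      obtain w where w: "w \<in> M" "\<forall>z\<in>M. gram p w z = (\<Sum>i<k. v i * gram p (e i) z)"
        using gram_combination_exists[OF p, where e = e and a = v and k = k, OF eM] by blast
      have "f w j = v j" for j
      proof (cases "j < k")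
        case True
        have "f w j = (\<Sum>i<k. v i * gram p (e i) (e j))"
          using w eM[OF True] True by (simp add: f_def)
        also have "\<dots> = (\<Sum>i<k. if i = j then v i else 0)"
          using True by (intro sum.cong) (auto simp: eo)
        finally show ?thesis
          using True by simp
      next
        case False
        then show ?thesis
          using v by (simp add: f_def euclidean_carrier_def topspace_Euclidean_space)
      qed
      then show ?thesis
        using w(1) by (metis image_eqI ext)
    qed
    then show "f ` M = euclidean_carrier k"
      using carrier by blast
  qed
  with dist have "isometric M d (euclidean_carrier k) (euclidean_dist k)"
    unfolding isometric_def by blast
  moreover have "0 < k"
  proof (rule ccontr)
    assume "\<not> 0 < k"
    then have "d x y = 0" if "x \<in> M" "y \<in> M" for x y
      using dist[OF that] by (simp add: euclidean_dist_def)
    then show False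
      using two_points by auto
  qed
  ultimately show ?thesis
    by blast
qed

end

section \<open>Geodesics and compact balls from dilation-homogeneity\<close>

context Metric_space
begin

lemma dilation_iff_similarity: "dilation M d u \<longleftrightarrow> (\<exists>r. similarity r u)"
  by (auto simp: dilation_def similarity_def)

text \<open>
The pair is moved in two steps, each of which fixes one of its points. If the target is the
pair in reverse order, or begins with the second point, then an intermediate step is needed; for the
exchange of the two points it passes through a third point.
\<close>

lemma similarity_on_pairs:
  assumes hom: "two_point_dilation_homogeneous M d"
    and three: "x \<in> M" "y \<in> M" "z \<in> M" "x \<noteq> y" "y \<noteq> z" "x \<noteq> z"
    and ab: "a \<in> M" "b \<in> M" "a \<noteq> b" and ab': "a' \<in> M" "b' \<in> M" "a' \<noteq> b'"
  shows "\<exists>r u. similarity r u \<and> u a = a' \<and> u b = b'"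
proof -
  define S where "S a b a' b' \<longleftrightarrow> (\<exists>r u. similarity r u \<and> u a = a' \<and> u b = b')" for a b a' b'
  have trans: "S a b a'' b''" if S: "S a b a' b'" "S a' b' a'' b''" for a b a' b' a'' b''
  proof -
    obtain r u s v where "similarity r u" "u a = a'" "u b = b'" "similarity s v" "v a' = a''" "v b' = b''"
      using S unfolding S_def by blast
    then show ?thesis
      unfolding S_def using similarity_compose[of r u s v] by (intro exI[of _ "s * r"] exI[of _ "v \<circ> u"]) auto
  qed
  have fix1: "S a b a c" if abc: "a \<in> M" "b \<in> M" "c \<in> M" "b \<noteq> a" "c \<noteq> a" for a b c
  proof (cases "b = c")
    case True
    have "similarity 1 id"
      by (simp add: similarity_def)
    with True show ?thesis
      unfolding S_def by (intro exI[of _ 1] exI[of _ id]) auto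
  next
    case False
    then have "a \<noteq> b \<and> b \<noteq> c \<and> a \<noteq> c"
      using abc by auto
    then obtain u where u: "dilation M d u" "u a = a" "u b = c"
      using hom[unfolded two_point_dilation_homogeneous_def, rule_format, OF abc(1-3)] by blast
    obtain r where "similarity r u"
      using u(1) unfolding dilation_iff_similarity by blast
    then show ?thesis
      unfolding S_def using u(2,3) by (intro exI[of _ r] exI[of _ u]) simp
  qed
  have fix2: "S a b c b" if "a \<in> M" "b \<in> M" "c \<in> M" "a \<noteq> b" "c \<noteq> b" for a b c
  proof -
    have "S b a b c"
      using fix1 that by auto
    then obtain r u where "similarity r u" "u b = b" "u a = c"
      unfolding S_def by auto
    then show ?thesis
      unfolding S_def by (intro exI[of _ r] exI[of _ u]) simp
  qed
  have "S a b a' b'"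
  proof (cases "b' = a")
    case False
    then show ?thesis
      using trans[OF fix1[of a b b'] fix2[of a b' a']] ab ab' by auto
  next
    case b': True
    show ?thesis
    proof (cases "a' = b")
      case False
      then show ?thesis
        using trans[OF fix2[of a b a'] fix1[of a' b b']] ab ab' by auto
    next
      case True
      obtain w where w: "w \<in> M" "w \<noteq> a" "w \<noteq> b"
        using three by metis
      have "S a b b w"
        using trans[OF fix1[of a b w] fix2[of a w b]] w ab by auto
      then show ?thesis
        using trans[OF _ fix1[of b w a]] w ab b' True by auto
    qed
  qed
  then show ?thesis
    by (simp add: S_def)
qed

lemma continuous_map_similarity: "similarity r u \<Longrightarrow> continuous_map mtopology mtopology u"
  unfolding metric_continuous_map[OF Metric_space_axioms]
proof (intro conjI ballI allI impI)
  assume u: "similarity r u"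
  note uD = similarityD[OF u]
  show "u ` M \<subseteq> M"
    using uD(3) by blast
  fix a and \<epsilon> :: real assume "a \<in> M" "0 < \<epsilon>"
  then show "\<exists>\<delta>>0. \<forall>x. x \<in> M \<and> d a x < \<delta> \<longrightarrow> d (u a) (u x) < \<epsilon>"
    using uD(1,4) by (intro exI[of _ "\<epsilon> / r"]) (auto simp: field_simps)
qed

text \<open>
Unequal distances in the triple give a dilation about \<open>p\<close> of ratio \<open>q > 1\<close>. Its powers enlarge the
image at \<open>p\<close> of a small ball inside \<open>K\<close> beyond any given radius.
\<close>

lemma compact_balls:
  assumes pairs: "\<And>a b a' b'. \<lbrakk>a \<in> M; b \<in> M; a \<noteq> b; a' \<in> M; b' \<in> M; a' \<noteq> b'\<rbrakk> \<Longrightarrow>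
      \<exists>r u. similarity r u \<and> u a = a' \<and> u b = b'"
    and xyz: "x \<in> M" "y \<in> M" "z \<in> M" "x \<noteq> y" "d x y < d x z"
    and K: "compactin mtopology K" "mtopology interior_of K \<noteq> {}"
  shows "compactin mtopology (mcball p R)"
proof (cases "p \<in> M")
  case False
  then have "mcball p R = {}"
    by (auto simp: mcball_def)
  then show ?thesis
    by simp
next
  case p: True
  obtain p0 e where p0: "p0 \<in> M" and e: "0 < e" "mcball p0 e \<subseteq> K"
    using K(2) in_interior_of_mcball by (metis ex_in_conv)
  have small: "compactin mtopology (mcball p0 e)"
    using closed_compactin[OF K(1) e(2) closedin_mcball] .
  have dxy: "0 < d x y"
    using xyz by simp
  define q where "q = d x z / d x y"
  have q: "1 < q"
    using xyz dxy by (simp add: q_def)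
  have other: "\<exists>b\<in>M. b \<noteq> a" for a
    using xyz by metis
  obtain b where b: "b \<in> M" "b \<noteq> p"
    using other by blast
  obtain b0 where b0: "b0 \<in> M" "b0 \<noteq> p0"
    using other by blast
  obtain r0 u0 where u0: "similarity r0 u0" "u0 p0 = p"
    using pairs[of p0 b0 p b] p p0 b b0 by metis
  obtain s w where w: "similarity s w" "w x = p" "w y = b"
    using pairs[of x y p b] xyz p b by metis
  note wD = similarityD[OF w(1)]
  have dw: "d p b = s * d x y" "d p (w z) = s * d x z" "w z \<in> M"
    using wD(3,4) w xyz by auto
  have "p \<noteq> w z"
    using dw wD(1) xyz dxy p by (metis mdist_zero mult_eq_0_iff less_trans less_irrefl)
  then obtain q' v where v: "similarity q' v" "v p = p" "v b = w z"
    using pairs[of p b p "w z"] p b dw by metis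
  have "q' * d p b = d p (w z)"
    using similarityD(4)[OF v(1) p b(1)] v by simp
  then have q': "q' = q"
    using dw wD(1) dxy by (simp add: q_def field_simps)
  have pow: "\<exists>u. similarity (q ^ n * r0) u \<and> u p0 = p" for n
  proof (induction n)
    case (Suc n)
    then obtain u where u: "similarity (q ^ n * r0) u" "u p0 = p"
      by blast
    show ?case
      using similarity_compose[OF u(1) v(1)] u(2) v(2) q'
      by (intro exI[of _ "v \<circ> u"]) (simp add: mult.assoc o_def)
  qed (use u0 in auto)
  have r0e: "0 < r0 * e"
    using similarityD(1)[OF u0(1)] e by simp
  obtain n where "R / (r0 * e) < q ^ n"
    using real_arch_pow[OF q] by blast
  then have n: "R < q ^ n * r0 * e"
    using r0e by (simp add: divide_less_eq mult.assoc)
  obtain u where u: "similarity (q ^ n * r0) u" "u p0 = p"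
    using pow by blast
  note uD = similarityD[OF u(1)]
  have "mcball p R \<subseteq> u ` mcball p0 e"
  proof
    fix t assume t: "t \<in> mcball p R"
    then have "t \<in> u ` M"
      using bij_betw_imp_surj_on[OF uD(2)] by simp
    then obtain t' where t': "t' \<in> M" "u t' = t"
      by blast
    then have "q ^ n * r0 * d p0 t' \<le> R"
      using uD(4)[OF p0 t'(1)] u(2) t by simp
    then have "q ^ n * r0 * d p0 t' \<le> q ^ n * r0 * e"
      using n by linarith
    then have "d p0 t' \<le> e"
      by (rule mult_le_cancel_left_pos[OF uD(1), THEN iffD1])
    then show "t \<in> u ` mcball p0 e"
      using t' p0 by auto
  qed
  moreover have "compactin mtopology (u ` mcball p0 e)"
    by (rule image_compactin[OF small continuous_map_similarity[OF u(1)]])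
  ultimately show ?thesis
    using closed_compactin[OF _ _ closedin_mcball] by blast
qed

text \<open>
The maps \<open>s \<mapsto> \<theta> s\<close> and \<open>s \<mapsto> \<theta> + (1 - \<theta>) s\<close> correspond to dividing the left and the
right part of a divided segment. Their images cover the unit interval, so iterating the division
approximates every proportion geometrically fast.
\<close>

lemma dense_between_points:
  assumes \<theta>: "0 < \<theta>" "\<theta> < (1 :: real)"
    and div: "\<And>a b. a \<in> M \<Longrightarrow> b \<in> M \<Longrightarrow> \<exists>m\<in>M. d a m = \<theta> * d a b \<and> d m b = (1 - \<theta>) * d a b"
    and ab: "a \<in> M" "b \<in> M" and t: "0 \<le> t" "t \<le> 1"
  shows "\<exists>s. \<exists>y\<in>M. d a y = s * d a b \<and> d y b = (1 - s) * d a b \<and> \<bar>s - t\<bar> \<le> max \<theta> (1 - \<theta>) ^ n"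
  using ab t
proof (induction n arbitrary: a b t)
  case 0
  then show ?case
    by (intro exI[of _ 0] bexI[of _ a]) auto
next
  case (Suc n)
  define \<mu> where "\<mu> = max \<theta> (1 - \<theta>)"
  have \<mu>: "0 \<le> \<mu>" "\<theta> \<le> \<mu>" "1 - \<theta> \<le> \<mu>"
    using \<theta> by (auto simp: \<mu>_def)
  obtain m where m: "m \<in> M" "d a m = \<theta> * d a b" "d m b = (1 - \<theta>) * d a b"
    using div Suc.prems by blast
  show ?case
  proof (cases "t \<le> \<theta>")
    case True
    then obtain s y where y: "y \<in> M" "d a y = s * d a m" "d y m = (1 - s) * d a m" "\<bar>s - t / \<theta>\<bar> \<le> \<mu> ^ n"
      using Suc.IH[of a m "t / \<theta>"] Suc.prems m \<theta> by (auto simp: \<mu>_def)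
    have "d y b = (1 - s * \<theta>) * d a b"
      using triangle[OF y(1) m(1) Suc.prems(2)] triangle[OF Suc.prems(1) y(1) Suc.prems(2)] m y
      by (simp add: algebra_simps)
    moreover have "\<bar>s * \<theta> - t\<bar> = \<theta> * \<bar>s - t / \<theta>\<bar>"
    proof -
      have "s * \<theta> - t = \<theta> * (s - t / \<theta>)"
        using \<theta> by (simp add: field_simps)
      then show ?thesis
        using \<theta> by (simp add: abs_mult)
    qed
    then have "\<bar>s * \<theta> - t\<bar> \<le> \<mu> ^ Suc n"
      using mult_mono[OF \<mu>(2) y(4)] \<mu> by simp
    ultimately show ?thesis
      using y m unfolding \<mu>_def[symmetric] by (intro exI[of _ "s * \<theta>"] bexI[of _ y]) auto
  next
    case False
    then obtain s y where y: "y \<in> M" "d m y = s * d m b" "d y b = (1 - s) * d m b" "\<bar>s - (t - \<theta>) / (1 - \<theta>)\<bar> \<le> \<mu> ^ n"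
      using Suc.IH[of m b "(t - \<theta>) / (1 - \<theta>)"] Suc.prems m \<theta> by (auto simp: \<mu>_def)
    define s' where "s' = \<theta> + s * (1 - \<theta>)"
    have yb: "d y b = (1 - s') * d a b"
      using y m by (simp add: s'_def algebra_simps)
    moreover have "d a y = s' * d a b"
      using triangle[OF Suc.prems(1) m(1) y(1)] triangle[OF Suc.prems(1) y(1) Suc.prems(2)] m y yb
      by (simp add: s'_def algebra_simps)
    moreover have "\<bar>s' - t\<bar> = (1 - \<theta>) * \<bar>s - (t - \<theta>) / (1 - \<theta>)\<bar>"
    proof -
      have "(1 - \<theta>) * ((t - \<theta>) / (1 - \<theta>)) = t - \<theta>"
        using \<theta> by simp
      then have "s' - t = (1 - \<theta>) * (s - (t - \<theta>) / (1 - \<theta>))"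
        unfolding right_diff_distrib[of "1 - \<theta>" s] by (simp add: s'_def mult.commute)
      then show ?thesis
        using \<theta> by (simp add: abs_mult)
    qed
    then have "\<bar>s' - t\<bar> \<le> \<mu> ^ Suc n"
      using mult_mono[OF \<mu>(3) y(4)] \<mu> by simp
    ultimately show ?thesis
      using y(1) unfolding \<mu>_def[symmetric] by (intro exI[of _ s'] bexI[of _ y]) auto
  qed
qed

lemma between_points:
  assumes \<theta>: "0 < \<theta>" "\<theta> < (1 :: real)"
    and div: "\<And>a b. a \<in> M \<Longrightarrow> b \<in> M \<Longrightarrow> \<exists>m\<in>M. d a m = \<theta> * d a b \<and> d m b = (1 - \<theta>) * d a b"
    and compact: "\<And>p R. compactin mtopology (mcball p R)"
    and ab: "a \<in> M" "b \<in> M" and t: "0 \<le> t" "t \<le> 1"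
  shows "\<exists>y\<in>M. d a y = t * d a b \<and> d y b = (1 - t) * d a b"
proof (cases "a = b")
  case True
  then show ?thesis
    using ab by auto
next
  case False
  then have D: "0 < d a b"
    using ab by simp
  define \<mu> where "\<mu> = max \<theta> (1 - \<theta>)"
  have \<mu>: "0 \<le> \<mu>" "\<mu> < 1"
    using \<theta> by (auto simp: \<mu>_def)
  have "\<forall>n. \<exists>s y. y \<in> M \<and> d a y = s * d a b \<and> d y b = (1 - s) * d a b \<and> \<bar>s - t\<bar> \<le> \<mu> ^ n"
    using dense_between_points[OF \<theta> div ab t] unfolding \<mu>_def by blast
  then obtain s y where y: "\<And>n. y n \<in> M \<and> d a (y n) = s n * d a b \<and> d (y n) b = (1 - s n) * d a b \<and> \<bar>s n - t\<bar> \<le> \<mu> ^ n"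
    by metis
  have "0 \<le> (1 - s n) * d a b" for n
    using y[of n] nonneg[of "y n" b] by simp
  then have "s n \<le> 1" for n
    using D by (simp add: zero_le_mult_iff)
  then have "s n * d a b \<le> d a b" for n
    using D by simp
  then have "range y \<subseteq> mcball a (d a b)"
    using y ab by auto
  then obtain l r where l: "strict_mono r" "limitin mtopology (y \<circ> r) l sequentially"
    using compact[of a "d a b"] unfolding compactin_sequentially by blast
  have lM: "l \<in> M" and lim0: "(\<lambda>n. d (y (r n)) l) \<longlonglongrightarrow> 0"
    using l(2) by (auto simp: limitin_metric_dist_null o_def)
  have "(\<lambda>n. \<mu> ^ r n) \<longlonglongrightarrow> 0"
    using LIMSEQ_subseq_LIMSEQ[OF LIMSEQ_realpow_zero[OF \<mu>] l(1)] by (simp add: o_def)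
  then have lim: "(\<lambda>n. d (y (r n)) l + \<mu> ^ r n * d a b) \<longlonglongrightarrow> 0 + 0 * d a b"
    by (intro tendsto_intros lim0)
  have err: "\<bar>s n - t\<bar> * d a b \<le> \<mu> ^ n * d a b" for n
    using y[of n] D by (intro mult_right_mono) auto
  have "\<bar>d a l - t * d a b\<bar> \<le> d (y (r n)) l + \<mu> ^ r n * d a b" for n
  proof -
    have "\<bar>d a l - d a (y (r n))\<bar> \<le> d (y (r n)) l"
      using mdist_reverse_triangle[of l a "y (r n)"] y[of "r n"] lM ab by (simp add: commute)
    moreover have "\<bar>d a (y (r n)) - t * d a b\<bar> = \<bar>s (r n) - t\<bar> * d a b"
      using y[of "r n"] by (simp add: abs_mult flip: left_diff_distrib)
    ultimately show ?thesis
      using err[of "r n"] by linarith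
  qed
  then have "\<bar>d a l - t * d a b\<bar> \<le> 0 + 0 * d a b"
    by (intro LIMSEQ_le_const[OF lim]) blast
  moreover have "\<bar>d l b - (1 - t) * d a b\<bar> \<le> d (y (r n)) l + \<mu> ^ r n * d a b" for n
  proof -
    have "\<bar>d l b - d (y (r n)) b\<bar> \<le> d (y (r n)) l"
      using mdist_reverse_triangle[of l b "y (r n)"] y[of "r n"] lM ab by (simp add: commute)
    moreover have "\<bar>d (y (r n)) b - (1 - t) * d a b\<bar> = \<bar>s (r n) - t\<bar> * d a b"
    proof -
      have "d (y (r n)) b - (1 - t) * d a b = (t - s (r n)) * d a b"
        using y[of "r n"] by (simp add: algebra_simps)
      then show ?thesis
        by (simp add: abs_mult abs_minus_commute)
    qed
    ultimately show ?thesis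
      using err[of "r n"] by linarith
  qed
  then have "\<bar>d l b - (1 - t) * d a b\<bar> \<le> 0 + 0 * d a b"
    by (intro LIMSEQ_le_const[OF lim]) blast
  ultimately show ?thesis
    using lM by auto
qed

text \<open>
The collinear triple enters twice: its proportion is transported to all pairs of points, and its
unequal distances show that not all dilations are isometries.
\<close>

theorem homogeneous_geodesic_spaceI:
  assumes hom: "two_point_dilation_homogeneous M d"
    and K: "compactin mtopology K" "mtopology interior_of K \<noteq> {}"
    and xyz: "x \<in> M" "y \<in> M" "z \<in> M" "x \<noteq> y" "y \<noteq> z" "x \<noteq> z" "metrically_collinear d x y z"
  shows "homogeneous_geodesic_space M d"
proof -
  note pairs = similarity_on_pairs[OF hom xyz(1-6)]
  have pos: "0 < d x y" "0 < d y z" "0 < d x z" and col: "d x z = d x y + d y z"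
    using xyz mdist_pos_less[of x z] by (auto simp: metrically_collinear_def simp del: mdist_pos_eq intro: mdist_pos_less)
  have compact: "compactin mtopology (mcball p R)" for p R
    using pos col by (intro compact_balls[OF pairs xyz(1-4) _ K]) auto
  define \<theta> where "\<theta> = d x y / d x z"
  have \<theta>: "0 < \<theta>" "\<theta> < 1" and dist: "d x y = \<theta> * d x z" "d y z = (1 - \<theta>) * d x z"
    using pos col by (auto simp: \<theta>_def field_simps)
  have div: "\<exists>m\<in>M. d a m = \<theta> * d a b \<and> d m b = (1 - \<theta>) * d a b" if ab: "a \<in> M" "b \<in> M" for a b
  proof (cases "a = b")
    case False
    then obtain r u where u: "similarity r u" "u x = a" "u z = b"
      using pairs[of x z a b] xyz ab by metis
    note uD = similarityD[OF u(1)]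
    have "d a (u y) = \<theta> * d a b" "d (u y) b = (1 - \<theta>) * d a b"
      using uD(4)[of x y] uD(4)[of y z] uD(4)[of x z] u xyz dist by simp_all
    then show ?thesis
      using uD(3) xyz(2) by blast
  qed (use ab in auto)
  show ?thesis
  proof (unfold_locales)
    show "\<exists>r u. similarity r u \<and> u a = a' \<and> u b = b'"
      if "a \<in> M" "b \<in> M" "a \<noteq> b" "a' \<in> M" "b' \<in> M" "a' \<noteq> b'" for a b a' b'
      by (rule pairs[OF that])
    show "\<exists>y\<in>M. d a y = t * d a b \<and> d y b = (1 - t) * d a b"
      if "a \<in> M" "b \<in> M" "0 \<le> t" "t \<le> 1" for a b t
      by (rule between_points[OF \<theta> div compact that])
    show "mtotally_bounded (mcball p r)" for p r
      by (rule compactin_imp_mtotally_bounded[OF compact])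
    show "\<exists>x\<in>M. \<exists>y\<in>M. x \<noteq> y"
      using xyz by blast
  qed
qed

end

section \<open>Isometric copies of Euclidean space\<close>

lemma isometric_two_point_dilation_homogeneous:
  assumes iso: "isometric M d M' d'" and hom: "two_point_dilation_homogeneous M' d'"
  shows "two_point_dilation_homogeneous M d"
proof -
  obtain f where f: "bij_betw f M M'" "\<And>x y. x \<in> M \<Longrightarrow> y \<in> M \<Longrightarrow> d' (f x) (f y) = d x y"
    using iso unfolding isometric_def by blast
  define g where "g = inv_into M f"
  have g: "bij_betw g M' M"
    unfolding g_def by (rule bij_betw_inv_into[OF f(1)])
  have fM: "f x \<in> M'" if "x \<in> M" for x
    using f(1) that by (auto simp: bij_betw_def)
  have gM: "g x \<in> M" if "x \<in> M'" for x
    using g that by (auto simp: bij_betw_def)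
  have gf: "g (f x) = x" if "x \<in> M" for x
    using that f(1) by (simp add: g_def bij_betw_inv_into_left)
  have fg: "f (g x) = x" if "x \<in> M'" for x
    using that f(1) by (simp add: g_def bij_betw_inv_into_right)
  have dg: "d (g x) (g y) = d' x y" if "x \<in> M'" "y \<in> M'" for x y
    using f(2)[OF gM gM, of x y] that fg by simp
  show ?thesis
    unfolding two_point_dilation_homogeneous_def
  proof (intro ballI impI)
    fix a b c assume M: "a \<in> M" "b \<in> M" "c \<in> M" and ne: "a \<noteq> b \<and> b \<noteq> c \<and> a \<noteq> c"
    then have "f a \<noteq> f b \<and> f b \<noteq> f c \<and> f a \<noteq> f c"
      using gf by metis
    then obtain u where u: "dilation M' d' u" "u (f a) = f a" "u (f b) = f c"
      using hom fM[OF M(1)] fM[OF M(2)] fM[OF M(3)] unfolding two_point_dilation_homogeneous_def by blast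
    obtain r where r: "bij_betw u M' M'" "0 < r" "\<And>x y. x \<in> M' \<Longrightarrow> y \<in> M' \<Longrightarrow> d' (u x) (u y) = r * d' x y"
      using u(1) unfolding dilation_def by blast
    have uM: "u x \<in> M'" if "x \<in> M'" for x
      using r(1) that by (auto simp: bij_betw_def)
    have "bij_betw (g \<circ> (u \<circ> f)) M M"
      by (intro bij_betw_trans[OF _ g] bij_betw_trans[OF f(1) r(1)])
    moreover have "d ((g \<circ> (u \<circ> f)) x) ((g \<circ> (u \<circ> f)) y) = r * d x y" if "x \<in> M" "y \<in> M" for x y
      using that by (simp add: dg uM fM r(3) f(2))
    ultimately have "dilation M d (g \<circ> (u \<circ> f))"
      unfolding dilation_def using r(2) by blast
    then show "\<exists>u. dilation M d u \<and> u a = a \<and> u b = c"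
      using u gf M by (intro exI[of _ "g \<circ> (u \<circ> f)"]) simp
  qed
qed

lemma isometric_compact_interior:
  assumes M: "Metric_space M d" and M': "Metric_space M' d'" and iso: "isometric M d M' d'"
    and K: "compactin (Metric_space.mtopology M' d') K" "Metric_space.mtopology M' d' interior_of K \<noteq> {}"
  shows "\<exists>K. compactin (Metric_space.mtopology M d) K \<and> Metric_space.mtopology M d interior_of K \<noteq> {}"
proof -
  interpret M: Metric_space M d
    by (rule M)
  interpret M': Metric_space M' d'
    by (rule M')
  obtain f where f: "bij_betw f M M'" "\<And>x y. x \<in> M \<Longrightarrow> y \<in> M \<Longrightarrow> d' (f x) (f y) = d x y"
    using iso unfolding isometric_def by blast
  define g where "g = inv_into M f"
  have g: "bij_betw g M' M"
    unfolding g_def by (rule bij_betw_inv_into[OF f(1)])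
  have fM: "f x \<in> M'" if "x \<in> M" for x
    using f(1) that by (auto simp: bij_betw_def)
  have gM: "g x \<in> M" if "x \<in> M'" for x
    using g that by (auto simp: bij_betw_def)
  have gf: "g (f x) = x" if "x \<in> M" for x
    using that f(1) by (simp add: g_def bij_betw_inv_into_left)
  have fg: "f (g x) = x" if "x \<in> M'" for x
    using that f(1) by (simp add: g_def bij_betw_inv_into_right)
  have dg: "d (g x) (g y) = d' x y" if "x \<in> M'" "y \<in> M'" for x y
    using f(2)[OF gM gM, of x y] that fg by simp
  have "continuous_map M'.mtopology M.mtopology g"
    unfolding M'.metric_continuous_map[OF M] using gM dg by auto
  then have "compactin M.mtopology (g ` K)"
    by (rule image_compactin[OF K(1)])
  moreover obtain x e where x: "x \<in> M'" "0 < e" "M'.mcball x e \<subseteq> K"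
    using K(2) M'.in_interior_of_mcball by (metis ex_in_conv)
  have "M.mcball (g x) e \<subseteq> g ` K"
  proof
    fix y assume y: "y \<in> M.mcball (g x) e"
    then have "f y \<in> M'.mcball x e"
      using fM f(2)[of "g x" y] x fg by simp
    then show "y \<in> g ` K"
      using x(3) gf[of y] y by (metis M.in_mcball imageI subsetD)
  qed
  then have "g x \<in> M.mtopology interior_of (g ` K)"
    using x gM M.in_interior_of_mcball by blast
  ultimately show ?thesis
    by blast
qed

definition dot :: "nat \<Rightarrow> (nat \<Rightarrow> real) \<Rightarrow> (nat \<Rightarrow> real) \<Rightarrow> real" where
  "dot n x y = (\<Sum>i<n. x i * y i)"

text \<open>
The reflection in the hyperplane orthogonal to \<open>v\<close>. As division by zero yields zero, it is the
identity if \<open>v\<close> vanishes on the first \<open>n\<close> coordinates; this absorbs the case in which the two vectors to be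
exchanged are equal.
\<close>

definition reflection :: "nat \<Rightarrow> (nat \<Rightarrow> real) \<Rightarrow> (nat \<Rightarrow> real) \<Rightarrow> (nat \<Rightarrow> real)" where
  "reflection n v x = (\<lambda>i. x i - 2 * dot n x v / dot n v v * v i)"

lemma euclidean_carrier_iff: "x \<in> euclidean_carrier n \<longleftrightarrow> (\<forall>i\<ge>n. x i = 0)"
  by (simp add: euclidean_carrier_def topspace_Euclidean_space)

lemma euclidean_dist_dot: "euclidean_dist n x y = sqrt (dot n (\<lambda>i. x i - y i) (\<lambda>i. x i - y i))"
  by (simp add: euclidean_dist_def dot_def power2_eq_square)

lemma dot_diff: "dot n (\<lambda>i. x i - y i) z = dot n x z - dot n y z" "dot n z (\<lambda>i. x i - y i) = dot n z x - dot n z y"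
  by (simp_all add: dot_def algebra_simps sum_subtractf)

lemma dot_scale: "dot n (\<lambda>i. c * x i) z = c * dot n x z" "dot n z (\<lambda>i. c * x i) = c * dot n z x"
  by (simp_all add: dot_def sum_distrib_left mult_ac)

lemma dot_commute: "dot n x y = dot n y x"
  by (simp add: dot_def mult.commute)

lemma dot_self_nonneg: "0 \<le> dot n x x"
  by (simp add: dot_def sum_nonneg)

lemma dot_self_eq_0: "dot n v v = 0 \<longleftrightarrow> (\<forall>i<n. v i = 0)"
  by (auto simp: dot_def sum_nonneg_eq_0_iff)

lemma dot_reflection: "dot n (reflection n v x) v = - dot n x v"
proof (cases "dot n v v = 0")
  case True
  then have "dot n x v = 0" "dot n (reflection n v x) v = 0"
    unfolding dot_self_eq_0 by (simp_all add: dot_def)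
  then show ?thesis
    by simp
next
  case False
  then show ?thesis
    unfolding reflection_def dot_diff dot_scale by simp
qed

lemma reflection_reflection: "reflection n v (reflection n v x) = x"
proof
  fix i
  have "reflection n v (reflection n v x) i = reflection n v x i + 2 * dot n x v / dot n v v * v i"
    unfolding reflection_def[of n v "reflection n v x"] dot_reflection by simp
  then show "reflection n v (reflection n v x) i = x i"
    by (simp add: reflection_def)
qed

lemma reflection_norm: "dot n (reflection n v x) (reflection n v x) = dot n x x"
proof -
  have "dot n (reflection n v x) (reflection n v x) =
    dot n (reflection n v x) x - 2 * dot n x v / dot n v v * dot n (reflection n v x) v"
    unfolding reflection_def[of n v x] dot_diff dot_scale by simp
  also have "dot n (reflection n v x) x = dot n x x - 2 * dot n x v / dot n v v * dot n x v"
    unfolding reflection_def dot_diff dot_scale by (simp add: dot_commute)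
  finally show ?thesis
    by (simp add: dot_reflection)
qed

lemma reflection_swap:
  assumes eq: "dot n x x = dot n y y" and xy: "x \<in> euclidean_carrier n" "y \<in> euclidean_carrier n"
  shows "reflection n (\<lambda>i. x i - y i) x = y"
proof -
  define v where "v = (\<lambda>i. x i - y i)"
  have *: "dot n v v = 2 * dot n x v"
    unfolding v_def dot_diff using eq by (simp add: dot_commute)
  show ?thesis
  proof (cases "dot n v v = 0")
    case True
    then have "x i = y i" for i
      using xy by (cases "i < n") (auto simp: v_def dot_self_eq_0 euclidean_carrier_iff)
    then have "x = y"
      by blast
    then show ?thesis
      by (simp add: reflection_def)
  next
    case False
    then show ?thesis
      unfolding v_def[symmetric] reflection_def * by (simp add: v_def)
  qed
qed

text \<open>
The dilation scales \<open>b - a\<close> to the length of \<open>c - a\<close> and then reflects it to \<open>c - a\<close>.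
\<close>

lemma euclidean_two_point_dilation_homogeneous:
  "two_point_dilation_homogeneous (euclidean_carrier n) (euclidean_dist n)"
  unfolding two_point_dilation_homogeneous_def
proof (intro ballI impI)
  fix a b c :: "nat \<Rightarrow> real"
  let ?E = "euclidean_carrier n"
  assume E: "a \<in> ?E" "b \<in> ?E" "c \<in> ?E" and ne: "a \<noteq> b \<and> b \<noteq> c \<and> a \<noteq> c"
  interpret E: Metric_space ?E "euclidean_dist n"
    by (rule Metric_space_euclidean)
  define r where "r = euclidean_dist n a c / euclidean_dist n a b"
  have pos: "0 < euclidean_dist n a b" "0 < euclidean_dist n a c"
    using E ne by auto
  then have r: "0 < r"
    by (simp add: r_def)
  define X where "X = (\<lambda>i. r * (b i - a i))"
  define Y where "Y = (\<lambda>i. c i - a i)"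
  define v where "v = (\<lambda>i. X i - Y i)"
  have XY: "X \<in> ?E" "Y \<in> ?E" and vE: "v \<in> ?E"
    using E by (auto simp: X_def Y_def v_def euclidean_carrier_iff)
  have sq: "(euclidean_dist n x y)\<^sup>2 = dot n (\<lambda>i. y i - x i) (\<lambda>i. y i - x i)" for x y
    unfolding E.commute[of x y] euclidean_dist_dot[of n y x] by (simp add: dot_self_nonneg)
  have "dot n X X = r\<^sup>2 * (euclidean_dist n a b)\<^sup>2"
    unfolding X_def dot_scale sq by (simp add: power2_eq_square)
  also have "\<dots> = dot n Y Y"
    using pos by (simp add: r_def Y_def power_divide flip: sq)
  finally have swap: "reflection n v X = Y"
    unfolding v_def by (intro reflection_swap XY)
  define u where "u x = (\<lambda>i. a i + reflection n v (\<lambda>i. r * (x i - a i)) i)" for x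
  define w where "w x = (\<lambda>i. a i + 1 / r * reflection n v (\<lambda>i. x i - a i) i)" for x
  have refl: "reflection n v x i = 0" if "i \<ge> n" "x i = 0" for x i
    using that vE by (simp add: reflection_def euclidean_carrier_iff)
  have scale: "reflection n v (\<lambda>i. k * x i) = (\<lambda>i. k * reflection n v x i)" for k x
    by (auto simp: reflection_def dot_scale algebra_simps)
  have "u (w x) = x" "w (u x) = x" for x
    unfolding u_def w_def using r by (simp_all add: scale reflection_reflection)
  moreover have "u x \<in> ?E" "w x \<in> ?E" if "x \<in> ?E" for x
    using that E refl by (auto simp: u_def w_def euclidean_carrier_iff)
  ultimately have "bij_betw u ?E ?E"
    by (intro bij_betw_byWitness[of _ w]) auto
  moreover have "euclidean_dist n (u x) (u y) = r * euclidean_dist n x y" for x y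
  proof -
    have "(\<lambda>i. u x i - u y i) = (\<lambda>i. r * reflection n v (\<lambda>i. x i - y i) i)"
      by (auto simp: u_def reflection_def dot_scale dot_diff algebra_simps diff_divide_distrib)
    then show ?thesis
      unfolding euclidean_dist_dot using r by (simp add: dot_scale reflection_norm real_sqrt_mult)
  qed
  ultimately have "dilation ?E (euclidean_dist n) u"
    unfolding dilation_def using r by blast
  moreover have "u a = a"
    by (simp add: u_def reflection_def dot_def)
  moreover have "u b = c"
    using swap by (simp add: u_def X_def[symmetric] Y_def)
  ultimately show "\<exists>u. dilation ?E (euclidean_dist n) u \<and> u a = a \<and> u b = c"
    by blast
qed

text \<open>
The compact set is a cube: it is compact for the product topology by Tychonoff's theorem, and the
identity from the product topology to the metric topology is continuous on it.
\<close>

lemma euclidean_compact_interior: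
  "\<exists>K. compactin (Metric_space.mtopology (euclidean_carrier n) (euclidean_dist n)) K \<and>
     Metric_space.mtopology (euclidean_carrier n) (euclidean_dist n) interior_of K \<noteq> {}"
proof -
  interpret E: Metric_space "euclidean_carrier n" "euclidean_dist n"
    by (rule Metric_space_euclidean)
  define C :: "(nat \<Rightarrow> real) set" where "C = (\<Pi>\<^sub>E i\<in>UNIV. if i < n then {-1..1} else {0})"
  have C_iff: "x \<in> C \<longleftrightarrow> (\<forall>i<n. \<bar>x i\<bar> \<le> 1) \<and> x \<in> euclidean_carrier n" for x
  proof -
    have "x i \<in> (if i < n then {-1..1} else {0}) \<longleftrightarrow> (i < n \<longrightarrow> \<bar>x i\<bar> \<le> 1) \<and> (n \<le> i \<longrightarrow> x i = 0)" for i
      by (cases "i < n") auto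
    then show ?thesis
      unfolding C_def PiE_UNIV_domain Pi_iff euclidean_carrier_iff by blast
  qed
  have "compactin (product_topology (\<lambda>i. euclidean) UNIV) C"
    unfolding C_def by (subst compactin_PiE) auto
  then have "compact C"
    by (simp add: euclidean_product_topology)
  then have "compactin (top_of_set C) C"
    by (simp add: compactin_subtopology)
  moreover have "continuous_map (top_of_set C) E.mtopology (\<lambda>x. x)"
    unfolding E.continuous_map_to_metric
  proof (intro ballI allI impI)
    fix x and \<epsilon> :: real assume x: "x \<in> topspace (top_of_set C)" and \<epsilon>: "0 < \<epsilon>"
    have "continuous_on C (\<lambda>y. euclidean_dist n x y)"
      unfolding euclidean_dist_def
      by (intro continuous_intros continuous_on_subset[OF continuous_on_product_coordinates]) auto
    then have "openin (top_of_set C) (C \<inter> (\<lambda>y. euclidean_dist n x y) -` {..<\<epsilon>})"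
      by (rule continuous_openin_preimage_gen) simp
    then show "\<exists>U. openin (top_of_set C) U \<and> x \<in> U \<and> (\<forall>y\<in>U. y \<in> E.mball x \<epsilon>)"
      using x \<epsilon> by (intro exI conjI) (auto simp: C_iff)
  qed
  ultimately have "compactin E.mtopology ((\<lambda>x. x) ` C)"
    by (rule image_compactin)
  then have "compactin E.mtopology C"
    by simp
  moreover have "E.mcball (\<lambda>_. 0) 1 \<subseteq> C"
  proof
    fix x assume x: "x \<in> E.mcball (\<lambda>_. 0) 1"
    have "\<bar>x i\<bar> \<le> 1" if "i < n" for i
    proof -
      have "(x i)\<^sup>2 \<le> (\<Sum>i<n. (x i)\<^sup>2)"
        using that by (intro member_le_sum) auto
      also have "\<dots> \<le> 1"
        using x by (simp add: euclidean_dist_def)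
      finally show ?thesis
        by (simp add: abs_square_le_1)
    qed
    then show "x \<in> C"
      using x by (simp add: C_iff)
  qed
  then have "(\<lambda>_. 0) \<in> E.mtopology interior_of C"
    unfolding E.in_interior_of_mcball by (intro conjI exI[of _ 1]) (auto simp: euclidean_carrier_iff)
  ultimately show ?thesis
    by blast
qed

lemma isometric_collinear_triple:
  assumes iso: "isometric M d (euclidean_carrier n) (euclidean_dist n)" and n: "0 < n"
  shows "\<exists>x\<in>M. \<exists>y\<in>M. \<exists>z\<in>M. x \<noteq> y \<and> y \<noteq> z \<and> x \<noteq> z \<and> metrically_collinear d x y z"
proof -
  obtain f where f: "bij_betw f M (euclidean_carrier n)"
      "\<And>x y. x \<in> M \<Longrightarrow> y \<in> M \<Longrightarrow> euclidean_dist n (f x) (f y) = d x y"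
    using iso unfolding isometric_def by blast
  define e where "e t = (\<lambda>i :: nat. if i = 0 then t else 0 :: real)" for t
  define x where "x t = inv_into M f (e t)" for t
  have "e t \<in> euclidean_carrier n" for t
    using n by (simp add: euclidean_carrier_iff e_def)
  then have "e t \<in> f ` M" for t
    using bij_betw_imp_surj_on[OF f(1)] by simp
  then have x: "x t \<in> M" "f (x t) = e t" for t
    by (simp_all add: x_def inv_into_into f_inv_into_f)
  have dist: "d (x s) (x t) = \<bar>s - t\<bar>" for s t
  proof -
    have "(\<Sum>i<n. (e s i - e t i)\<^sup>2) = (\<Sum>i<n. if i = 0 then (s - t)\<^sup>2 else 0)"
      by (intro sum.cong) (auto simp: e_def)
    then show ?thesis
      using f(2)[OF x(1) x(1), of s t] n by (simp add: x(2) euclidean_dist_def)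
  qed
  have "x s \<noteq> x t" if "s \<noteq> t" for s t
    using dist[of s t] dist[of s s] that by auto
  then show ?thesis
    using x(1) dist by (intro bexI[of _ "x 0"] bexI[of _ "x 1"] bexI[of _ "x 2"]) (auto simp: metrically_collinear_def)
qed

section \<open>The characterization\<close>

theorem theorem1p2:
  fixes M :: "'a set" and d :: "'a \<Rightarrow> 'a \<Rightarrow> real"
  assumes "Metric_space M d"
  shows "(\<exists>n::nat. n > 0 \<and> isometric M d (euclidean_carrier n) (euclidean_dist n)) \<longleftrightarrow>
         two_point_dilation_homogeneous M d \<and>
         (\<exists>K. compactin (Metric_space.mtopology M d) K \<and>
              (Metric_space.mtopology M d) interior_of K \<noteq> {}) \<and>
         (\<exists>x\<in>M. \<exists>y\<in>M. \<exists>z\<in>M. x \<noteq> y \<and> y \<noteq> z \<and> x \<noteq> z \<and> metrically_collinear d x y z)"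
  (is "?euclidean \<longleftrightarrow> ?homogeneous \<and> ?compact \<and> ?collinear")
proof
  assume ?euclidean
  then obtain n where n: "0 < n" and iso: "isometric M d (euclidean_carrier n) (euclidean_dist n)"
    by blast
  obtain K where K: "compactin (Metric_space.mtopology (euclidean_carrier n) (euclidean_dist n)) K"
      "Metric_space.mtopology (euclidean_carrier n) (euclidean_dist n) interior_of K \<noteq> {}"
    using euclidean_compact_interior by blast
  show "?homogeneous \<and> ?compact \<and> ?collinear"
    using isometric_two_point_dilation_homogeneous[OF iso euclidean_two_point_dilation_homogeneous]
      isometric_compact_interior[OF assms Metric_space_euclidean iso K] isometric_collinear_triple[OF iso n]
    by blast
next
  interpret Metric_space M d
    by (rule assms)
  assume "?homogeneous \<and> ?compact \<and> ?collinear"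
  then obtain K x y z where "?homogeneous" "compactin mtopology K" "mtopology interior_of K \<noteq> {}"
      "x \<in> M" "y \<in> M" "z \<in> M" "x \<noteq> y" "y \<noteq> z" "x \<noteq> z" "metrically_collinear d x y z"
    by blast
  then interpret homogeneous_geodesic_space M d
    by (rule homogeneous_geodesic_spaceI)
  show ?euclidean
    using isometric_euclidean by blast
qed

end
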